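(* Let $r\ge 1$ be an integer, $\varepsilon>0$, and $\frac12<\delta\le \frac12+\frac{1}{2(2r+1)}$. Then for all sufficiently large integers $s$ we have \[ \mathbf{RT}_s(n,K_{s+r},n^\delta)=\Omega\big(n^{2-(1-\delta)/r-\varepsilon}\big) \] as $n\to\infty$. Furthermore, if $r\ge 2$, then there exists a positive constant $C=C(s)$ such that for all sufficiently large $s$, \[ \mathbf{RT}_s(n,K_{s+r},C\sqrt{n})=\Omega\big(n^{2-1/(2r)-\varepsilon}\big). \]
   Context: For a graph $G$ and integer $s\ge 2$, the $s$-independence number $\alpha_s(G)$ is the maximum number of vertices of an induced subgraph of $G$ containing no copy of $K_s$. For a graph $H$ and a function $f=f(n)$, the Ramsey–Turán number $\mathbf{RT}_s(n,H,f)$ is the maximum number of edges of an $H$-free graph $G$ on $n$ vertices with $\alpha_s(G)<f$; if no such graph exists, $\mathbf{RT}_s(n,H,f)=0$. Asymptotic notation is as $n\to\infty$ with all other parameters ($r,s,\delta,\varepsilon$) fixed; implicit constants may depend on them. Rounding of non-integer quantities such as $n^\delta$ is ignored. *)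

theory Defs
  imports Complex_Main "HOL-Library.Landau_Symbols"
begin

record 'a ugraph =
  verts :: "'a set"
  edges :: "'a set set"

definition simple_graph :: "'a ugraph \<Rightarrow> bool" where
  "simple_graph G \<longleftrightarrow>
     finite (verts G) \<and> (\<forall>e\<in>edges G. e \<subseteq> verts G \<and> card e = 2)"

(* A copy is a subgraph isomorphic to H, not necessarily induced. *)
definition contains_copy :: "'a ugraph \<Rightarrow> 'b ugraph \<Rightarrow> bool" where
  "contains_copy G H \<longleftrightarrow>
     (\<exists>\<phi>. inj_on \<phi> (verts H) \<and> \<phi> ` verts H \<subseteq> verts G \<and>
          (\<forall>e\<in>edges H. \<phi> ` e \<in> edges G))"

abbreviation free_of :: "'a ugraph \<Rightarrow> 'b ugraph \<Rightarrow> bool" where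
  "free_of G H \<equiv> \<not> contains_copy G H"

definition induced_subgraph :: "'a ugraph \<Rightarrow> 'a set \<Rightarrow> 'a ugraph" where
  "induced_subgraph G W = \<lparr>verts = W, edges = {e \<in> edges G. e \<subseteq> W}\<rparr>"

definition complete_graph :: "nat \<Rightarrow> nat ugraph" where
  "complete_graph m = \<lparr>verts = {..<m}, edges = {e. e \<subseteq> {..<m} \<and> card e = 2}\<rparr>"

(* Meaningful for finite G and s > 0: the empty vertex set then always qualifies. *)
definition indep_number :: "nat \<Rightarrow> 'a ugraph \<Rightarrow> nat" where
  "indep_number s G =
     Max {card W | W. W \<subseteq> verts G \<and> free_of (induced_subgraph G W) (complete_graph s)}"

(* Up to isomorphism every finite graph has its vertices in nat, so ranging over nat ugraph
   loses nothing. The bound f n is compared as a real number, without rounding. *)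
definition RT_graphs :: "nat \<Rightarrow> nat \<Rightarrow> 'b ugraph \<Rightarrow> (nat \<Rightarrow> real) \<Rightarrow> nat ugraph set" where
  "RT_graphs s n H f =
     {G. simple_graph G \<and> card (verts G) = n \<and> free_of G H \<and> real (indep_number s G) < f n}"

definition RT :: "nat \<Rightarrow> nat \<Rightarrow> 'b ugraph \<Rightarrow> (nat \<Rightarrow> real) \<Rightarrow> nat" where
  "RT s n H f =
     (if RT_graphs s n H f = {} then 0 else Max ((\<lambda>G. card (edges G)) ` RT_graphs s n H f))"

end

theory Submission
  imports Defs "HOL-Number_Theory.Cong" "HOL-Real_Asymp.Real_Asymp" "HOL-Library.Discrete_Functions"
    "HOL-Library.FuncSet"
begin

text \<open>
  Take \<open>n\<close> points of an affine plane of prime order \<open>q\<close> with \<open>n \<le> q\<^sup>2 \<le> 25 n\<close>. Select each line with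
  probability \<open>1 / T\<close>, split the points of a selected line at random into \<open>K\<close> blocks, and turn each block
  into a random complete \<open>s\<close>-partite graph. A vertex set of size \<open>w\<close> of order \<open>q K\<close> meets a positive
  proportion of the \<open>q\<^sup>2\<close> lines in at least \<open>w / (2 q)\<close> points, so it fails to contain a \<open>K\<^sub>s\<close> inside a
  block with probability \<open>exp (- \<Omega>(q\<^sup>2 / T))\<close>, which beats the \<open>q powr (2 * w)\<close> choices of the set.
  A clique on \<open>s + r\<close> vertices contains, for large \<open>s\<close>, either \<open>M\<close> points of one block with \<open>r\<close> points off
  that line joined to all of them by \<open>r M\<close> distinct lines, or \<open>k\<close> points no three of which are on a line.
  As soon as \<open>(T K) ^ r\<close> exceeds the block size \<open>q / K\<close> by a factor \<open>q powr (r * \<epsilon>)\<close>, the expected number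
  of both configurations is smaller than any prescribed power of \<open>q\<close> once \<open>M\<close> and \<open>k\<close> are large, so that
  an outcome with the expected order \<open>n\<^sup>2 / (T K)\<close> of edges survives.
\<close>

section \<open>Frequencies in finite sets\<close>

text \<open>The exponent comes from the cones. Choosing the base costs a factor \<open>q\<close> for
  each of its \<open>M\<close> points, and each of them pays \<open>1 / K\<close> for lying in the
  common block and \<open>1 / (T K) ^ r\<close> for its joins to the \<open>r\<close> apexes. With
  \<open>K\<close> about \<open>q powr \<eta>\<close> and \<open>T K\<close> about
  \<open>q powr \<theta>\<close> this balances at \<eta> + r \<theta> = 1; a surplus of r \<epsilon>
  there gives \<open>q powr (- r \<epsilon>)\<close> for each point, so a large \<open>M\<close>
  beats any fixed power of \<open>q\<close>. Bad outcomes can therefore be made rarer than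
  \<open>1 / (T K)\<close>, and neither a deletion of vertices nor a concentration bound for the
  edges is required. The pull in the other direction comes from the sets of size about
  \<open>q powr (1 + \<eta>)\<close>: the exponent \<open>q^2 / T\<close> of their failure must
  exceed that size, which asks for \<theta> < 1. For r = 1 this forces \<eta> > 0, that is, a bound
  above the order of sqrt n; for r \<ge> 2 even \<eta> = 0 is possible. As \<open>q\<close> is about
  sqrt n, the size is about \<open>n powr ((1 + \<eta>) / 2)\<close>, so \<eta> is taken near 2
  \<delta> - 1.\<close>

definition freq :: "'a set \<Rightarrow> ('a \<Rightarrow> bool) \<Rightarrow> real" where
  "freq A P = real (card {x \<in> A. P x}) / real (card A)"

lemma freq_nonneg: "freq A P \<ge> 0"
  by (simp add: freq_def)

lemma freq_mono:
  assumes "finite A" "\<And>x. x \<in> A \<Longrightarrow> P x \<Longrightarrow> Q x"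
  shows "freq A P \<le> freq A Q"
proof -
  have "card {x \<in> A. P x} \<le> card {x \<in> A. Q x}"
    using assms by (intro card_mono) auto
  then show ?thesis by (simp add: freq_def divide_right_mono)
qed

lemma freq_cong:
  assumes "\<And>x. x \<in> A \<Longrightarrow> P x \<longleftrightarrow> Q x"
  shows "freq A P = freq A Q"
proof -
  have "{x \<in> A. P x} = {x \<in> A. Q x}" using assms by auto
  then show ?thesis by (simp add: freq_def)
qed

lemma freq_Bex_le:
  assumes "finite I"
  shows "freq A (\<lambda>x. \<exists>i\<in>I. P i x) \<le> (\<Sum>i\<in>I. freq A (P i))"
proof -
  have "{x \<in> A. \<exists>i\<in>I. P i x} = (\<Union>i\<in>I. {x \<in> A. P i x})" by auto
  then have "card {x \<in> A. \<exists>i\<in>I. P i x} \<le> (\<Sum>i\<in>I. card {x \<in> A. P i x})"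
    using card_UN_le[OF assms, of "\<lambda>i. {x \<in> A. P i x}"] by simp
  then have "real (card {x \<in> A. \<exists>i\<in>I. P i x}) \<le> (\<Sum>i\<in>I. real (card {x \<in> A. P i x}))"
    by (simp flip: of_nat_sum)
  then show ?thesis
    by (simp add: freq_def sum_divide_distrib[symmetric] divide_right_mono)
qed

lemma freq_Bex_disjoint:
  assumes "finite A" "finite I"
    and "\<And>i j x. i \<in> I \<Longrightarrow> j \<in> I \<Longrightarrow> P i x \<Longrightarrow> P j x \<Longrightarrow> i = j"
  shows "freq A (\<lambda>x. \<exists>i\<in>I. P i x) = (\<Sum>i\<in>I. freq A (P i))"
proof -
  have "{x \<in> A. \<exists>i\<in>I. P i x} = (\<Union>i\<in>I. {x \<in> A. P i x})" by auto
  moreover have "card (\<Union>i\<in>I. {x \<in> A. P i x}) = (\<Sum>i\<in>I. card {x \<in> A. P i x})"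
    using assms by (intro card_UN_disjoint) auto
  ultimately have "card {x \<in> A. \<exists>i\<in>I. P i x} = (\<Sum>i\<in>I. card {x \<in> A. P i x})"
    by simp
  then show ?thesis by (simp add: freq_def sum_divide_distrib)
qed

lemma freq_disj_le: "freq A (\<lambda>x. P x \<or> Q x) \<le> freq A P + freq A Q"
proof -
  have "{x \<in> A. P x \<or> Q x} = {x \<in> A. P x} \<union> {x \<in> A. Q x}" by auto
  then have "card {x \<in> A. P x \<or> Q x} \<le> card {x \<in> A. P x} + card {x \<in> A. Q x}"
    by (simp add: card_Un_le)
  then show ?thesis
    by (simp add: freq_def add_divide_distrib[symmetric] divide_right_mono del: of_nat_add flip: of_nat_add)
qed

lemma freq_not:
  assumes "finite A" "A \<noteq> {}"
  shows "freq A (\<lambda>x. \<not> P x) = 1 - freq A P"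
proof -
  have "{x \<in> A. P x} \<union> {x \<in> A. \<not> P x} = A" by auto
  then have "card {x \<in> A. P x} + card {x \<in> A. \<not> P x} = card A"
    using assms(1) card_Un_disjoint[of "{x \<in> A. P x}" "{x \<in> A. \<not> P x}"]
    by (simp add: disjoint_iff)
  then have "real (card {x \<in> A. P x}) + real (card {x \<in> A. \<not> P x}) = real (card A)"
    by (metis of_nat_add)
  moreover have "real (card A) > 0" using assms by (simp add: card_gt_0_iff)
  ultimately show ?thesis by (simp add: freq_def field_simps)
qed

lemma freq_Times:
  assumes "finite A" "finite B"
  shows "freq (A \<times> B) (\<lambda>(a, b). P a \<and> Q b) = freq A P * freq B Q"
proof -
  have "{x \<in> A \<times> B. case x of (a, b) \<Rightarrow> P a \<and> Q b} = {a \<in> A. P a} \<times> {b \<in> B. Q b}"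
    by auto
  then show ?thesis by (simp add: freq_def card_cartesian_product)
qed

text \<open>Independence of the coordinates of a uniformly random function. It serves twice: for the
  colours of the points in one label, and for the labels of distinct lines.\<close>

lemma freq_PiE:
  assumes "finite I" "S \<subseteq> I" "finite C" "C \<noteq> {}"
  shows "freq (I \<rightarrow>\<^sub>E C) (\<lambda>f. \<forall>i\<in>S. P i (f i)) = (\<Prod>i\<in>S. freq C (P i))"
proof -
  have eq: "{f \<in> I \<rightarrow>\<^sub>E C. \<forall>i\<in>S. P i (f i)} = PiE I (\<lambda>i. if i \<in> S then {c \<in> C. P i c} else C)"
    using assms(2) by (fastforce simp: PiE_iff split: if_splits)
  have "freq (I \<rightarrow>\<^sub>E C) (\<lambda>f. \<forall>i\<in>S. P i (f i))
      = (\<Prod>i\<in>I. (if i \<in> S then real (card {c \<in> C. P i c}) else real (card C)) / real (card C))"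
    unfolding freq_def eq card_PiE[OF assms(1)] prod_dividef
    by (simp add: if_distrib[of card] if_distrib[of real] cong: if_cong)
  also have "\<dots> = (\<Prod>i\<in>I. if i \<in> S then freq C (P i) else 1)"
    using assms(3,4) by (intro prod.cong) (auto simp: freq_def)
  also have "\<dots> = (\<Prod>i\<in>S. freq C (P i))"
    using assms(1,2) by (simp add: prod.If_cases Int_absorb1)
  finally show ?thesis .
qed

text \<open>Even if \<open>g\<close> attains \<open>B\<close> on all of \<open>P\<close>, that part
  contributes less than \<open>m / 2\<close> to the mean, so the rest must reach
  \<open>m / 2\<close> somewhere. This replaces any concentration estimate for the number of
  edges.\<close>

lemma exists_large_avoiding:
  fixes g :: "'a \<Rightarrow> real"
  assumes "finite A" "A \<noteq> {}" "(\<Sum>x\<in>A. g x) \<ge> m * real (card A)"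
    and "\<And>x. x \<in> A \<Longrightarrow> g x \<le> B" "B * freq A P < m / 2" "m > 0"
  shows "\<exists>x\<in>A. \<not> P x \<and> g x \<ge> m / 2"
proof (rule ccontr)
  assume *: "\<not> ?thesis"
  have c: "real (card A) > 0" using assms by (simp add: card_gt_0_iff)
  have le: "g x \<le> (if P x then B else m / 2)" if "x \<in> A" for x
    using * assms(4) that by force
  have "(\<Sum>x\<in>A. g x) \<le> (\<Sum>x\<in>A. if P x then B else m / 2)"
    using le by (rule sum_mono)
  also have "\<dots> = B * real (card {x \<in> A. P x}) + m / 2 * real (card {x \<in> A. \<not> P x})"
    using assms(1) by (simp add: sum.If_cases Int_def Compl_eq)
  also have "\<dots> = (B * freq A P + m / 2 * freq A (\<lambda>x. \<not> P x)) * real (card A)"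
    using c by (simp add: freq_def field_simps)
  also have "\<dots> < (m / 2 + m / 2 * 1) * real (card A)"
    using assms c freq_nonneg[of A P] freq_not[OF assms(1,2), of P]
    by (intro mult_strict_right_mono add_less_le_mono mult_left_mono) auto
  finally show False using assms(3) by simp
qed

section \<open>Random labels of a line\<close>

text \<open>A label \<open>(t, f)\<close> of a line selects the line iff \<open>t = 0\<close>, an event of frequency \<open>1 / T\<close>.
  The colour \<open>f v\<close> encodes both the block \<open>f v div s\<close> of \<open>v\<close> and its part \<open>f v mod s\<close> within the block.\<close>

definition labels :: "'v set \<Rightarrow> nat \<Rightarrow> nat \<Rightarrow> nat \<Rightarrow> (nat \<times> ('v \<Rightarrow> nat)) set" where
  "labels V T K s = {..<T} \<times> (V \<rightarrow>\<^sub>E {..<K * s})"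

definition same_block :: "nat \<Rightarrow> nat \<times> ('v \<Rightarrow> nat) \<Rightarrow> 'v set \<Rightarrow> bool" where
  "same_block s y U \<longleftrightarrow> fst y = 0 \<and> (\<forall>u\<in>U. \<forall>v\<in>U. snd y u div s = snd y v div s)"

definition joined :: "nat \<Rightarrow> nat \<times> ('v \<Rightarrow> nat) \<Rightarrow> 'v \<Rightarrow> 'v \<Rightarrow> bool" where
  "joined s y u v \<longleftrightarrow> fst y = 0 \<and> snd y u div s = snd y v div s \<and> snd y u \<noteq> snd y v"

text \<open>Only block \<open>0\<close>, that is the colours below \<open>s\<close>, is asked to contain a \<open>K\<^sub>s\<close>.\<close>

definition rainbow :: "nat \<Rightarrow> nat \<times> ('v \<Rightarrow> nat) \<Rightarrow> 'v set \<Rightarrow> bool" where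
  "rainbow s y W \<longleftrightarrow> fst y = 0 \<and> (\<forall>j<s. \<exists>v\<in>W. snd y v = j)"

lemma finite_labels: "finite V \<Longrightarrow> finite (labels V T K s)"
  by (simp add: labels_def finite_PiE)

lemma labels_nonempty: "T > 0 \<Longrightarrow> K > 0 \<Longrightarrow> s > 0 \<Longrightarrow> labels V T K s \<noteq> {}"
  by (auto simp: labels_def PiE_eq_empty_iff lessThan_empty_iff)

lemma freq_lessThan_eq: "i < n \<Longrightarrow> freq {..<n} (\<lambda>c. c = i) = 1 / real n"
proof -
  assume "i < n"
  then have "{c \<in> {..<n}. c = i} = {i}" by auto
  then show ?thesis by (simp add: freq_def)
qed

lemma div_eq_iff_interval: "(s::nat) > 0 \<Longrightarrow> c div s = k \<longleftrightarrow> k * s \<le> c \<and> c < (k + 1) * s"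
  by (metis Suc_eq_plus1 div_less_iff_less_mult less_eq_div_iff_mult_less_eq less_Suc_eq_le order_antisym_conv order_refl)

lemma freq_div_eq:
  assumes "k < K" "s > 0"
  shows "freq {..<K * s} (\<lambda>c. c div s = k) = 1 / real K"
proof -
  have "(k + 1) * s \<le> K * s" using assms by (intro mult_right_mono) auto
  then have "{c \<in> {..<K * s}. c div s = k} = {k * s..<(k + 1) * s}"
    using assms by (auto simp: div_eq_iff_interval)
  then show ?thesis using assms by (simp add: freq_def)
qed

lemma freq_labels:
  assumes "finite V" "T > 0"
  shows "freq (labels V T K s) (\<lambda>y. fst y = 0 \<and> Q (snd y)) =
         1 / real T * freq (V \<rightarrow>\<^sub>E {..<K * s}) Q"
proof -
  have "freq (labels V T K s) (\<lambda>y. fst y = 0 \<and> Q (snd y)) =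
        freq ({..<T} \<times> (V \<rightarrow>\<^sub>E {..<K * s})) (\<lambda>(a, b). a = 0 \<and> Q b)"
    unfolding labels_def by (intro freq_cong) auto
  also have "\<dots> = 1 / real T * freq (V \<rightarrow>\<^sub>E {..<K * s}) Q"
    using assms by (subst freq_Times) (simp_all add: finite_PiE freq_lessThan_eq)
  finally show ?thesis .
qed

text \<open>One point chooses its block freely and the others must follow, hence the exponent
  \<open>card U - 1\<close>: a union over \<open>K\<close> blocks of events of frequency
  \<open>(1 / K) ^ card U\<close>.\<close>

lemma freq_same_block:
  assumes "finite V" "T > 0" "K > 0" "s > 0" "U \<subseteq> V" "U \<noteq> {}"
  shows "freq (labels V T K s) (\<lambda>y. same_block s y U) \<le> 1 / real T * (1 / real K) ^ (card U - 1)"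
proof -
  let ?F = "V \<rightarrow>\<^sub>E {..<K * s}"
  have fin: "finite ?F" using assms by (simp add: finite_PiE)
  obtain u0 where u0: "u0 \<in> U" using assms by blast
  have cardU: "card U \<ge> 1" using assms by (metis One_nat_def Suc_leI card_gt_0_iff finite_subset)
  have "freq ?F (\<lambda>f. \<forall>u\<in>U. \<forall>v\<in>U. f u div s = f v div s)
      \<le> freq ?F (\<lambda>f. \<exists>k\<in>{..<K}. \<forall>u\<in>U. f u div s = k)"
  proof (rule freq_mono[OF fin])
    fix f assume f: "f \<in> ?F" "\<forall>u\<in>U. \<forall>v\<in>U. f u div s = f v div s"
    then have "f u0 < K * s" using u0 assms by auto
    then have "f u0 div s < K" by (simp add: less_mult_imp_div_less)
    then show "\<exists>k\<in>{..<K}. \<forall>u\<in>U. f u div s = k" using f u0 by blast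
  qed
  also have "\<dots> \<le> (\<Sum>k<K. freq ?F (\<lambda>f. \<forall>u\<in>U. f u div s = k))"
    by (rule freq_Bex_le) simp
  also have "\<dots> = (\<Sum>k<K. (1 / real K) ^ card U)"
  proof (rule sum.cong[OF refl])
    fix k assume "k \<in> {..<K}"
    then have "freq {..<K * s} (\<lambda>c. c div s = k) = 1 / real K" using assms freq_div_eq by blast
    then show "freq ?F (\<lambda>f. \<forall>u\<in>U. f u div s = k) = (1 / real K) ^ card U"
      using assms by (subst freq_PiE[of V U _ "\<lambda>_ c. c div s = k"]) (auto simp: lessThan_empty_iff)
  qed
  also have "\<dots> = (1 / real K) ^ (card U - 1)"
    using cardU assms(3) by (cases "card U") (simp_all add: field_simps)
  finally have "freq ?F (\<lambda>f. \<forall>u\<in>U. \<forall>v\<in>U. f u div s = f v div s) \<le> (1 / real K) ^ (card U - 1)" .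
  then show ?thesis
    unfolding same_block_def using assms
    by (subst freq_labels) (auto intro!: divide_right_mono)
qed

text \<open>Given the colour of \<open>u\<close>, exactly \<open>s - 1\<close> of the
  \<open>K * s\<close> colours put \<open>v\<close> into the same block but another part, and
  \<open>s \<ge> 2\<close> makes this at least half of the block.\<close>

lemma freq_joined:
  assumes "finite V" "T > 0" "K > 0" "s \<ge> 2" "u \<in> V" "v \<in> V" "u \<noteq> v"
  shows "freq (labels V T K s) (\<lambda>y. joined s y u v) \<ge> 1 / (2 * real T * real K)"
proof -
  let ?F = "V \<rightarrow>\<^sub>E {..<K * s}"
  have fin: "finite ?F" using assms by (simp add: finite_PiE)
  \<comment> \<open>For a fixed colour \<open>c\<close> of \<open>u\<close> the event is one
    condition per vertex, to which \<open>freq_PiE\<close> applies; the events for different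
    \<open>c\<close> are disjoint.\<close>
  define P where "P = (\<lambda>c z d. if z = u then d = c else d div s = c div s \<and> d \<noteq> (c::nat))"
  have 1: "freq {..<K * s} (P c v) = real (s - 1) / real (K * s)" if "c < K * s" for c
  proof -
    have lt: "c div s < K" using that by (simp add: less_mult_imp_div_less)
    have "(c div s + 1) * s \<le> K * s" using lt by (intro mult_right_mono) auto
    then have "{d \<in> {..<K * s}. P c v d} = {c div s * s..<(c div s + 1) * s} - {c}"
      using assms by (auto simp: P_def div_eq_iff_interval)
    moreover have "c \<in> {c div s * s..<(c div s + 1) * s}"
      using assms div_eq_iff_interval[of s c "c div s"] by auto
    ultimately have "card {d \<in> {..<K * s}. P c v d} = s - 1" by simp
    then show ?thesis by (simp add: freq_def)
  qed
  have "freq ?F (\<lambda>f. f u div s = f v div s \<and> f u \<noteq> f v)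
      = freq ?F (\<lambda>f. \<exists>c\<in>{..<K * s}. \<forall>z\<in>{u, v}. P c z (f z))"
    using assms by (intro freq_cong) (auto simp: P_def)
  also have "\<dots> = (\<Sum>c<K * s. freq ?F (\<lambda>f. \<forall>z\<in>{u, v}. P c z (f z)))"
    using fin by (intro freq_Bex_disjoint) (auto simp: P_def)
  also have "\<dots> = (\<Sum>c<K * s. 1 / real (K * s) * (real (s - 1) / real (K * s)))"
  proof (rule sum.cong[OF refl])
    fix c assume c: "c \<in> {..<K * s}"
    have "freq {..<K * s} (P c u) = 1 / real (K * s)"
      using c freq_lessThan_eq[of c "K * s"] by (simp add: P_def)
    moreover have "freq ?F (\<lambda>f. \<forall>z\<in>{u, v}. P c z (f z)) = (\<Prod>z\<in>{u, v}. freq {..<K * s} (P c z))"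
      using assms c by (intro freq_PiE) (auto simp: lessThan_empty_iff)
    ultimately show "freq ?F (\<lambda>f. \<forall>z\<in>{u, v}. P c z (f z)) =
      1 / real (K * s) * (real (s - 1) / real (K * s))"
      using 1 c assms(7) by simp
  qed
  also have "\<dots> = real (s - 1) / real (K * s)" using assms by simp
  also have "\<dots> \<ge> 1 / (2 * real K)"
    using assms by (simp add: field_simps of_nat_diff)
  finally have "1 / (2 * real K) \<le> freq ?F (\<lambda>f. f u div s = f v div s \<and> f u \<noteq> f v)" .
  then have "1 / real T * (1 / (2 * real K)) \<le> 1 / real T * freq ?F (\<lambda>f. f u div s = f v div s \<and> f u \<noteq> f v)"
    by (intro mult_left_mono) auto
  then show ?thesis unfolding joined_def using assms by (subst freq_labels) (auto simp: mult_ac)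
qed

text \<open>The size of \<open>W\<close> makes each colour below \<open>s\<close> absent with
  frequency at most \<open>exp (- 2 s)\<close>, hence at most \<open>1 / (2 s)\<close>. Summed over
  the \<open>s\<close> colours this leaves \<open>1 / 2\<close>, and the selection of the line
  contributes \<open>1 / T\<close>.\<close>

lemma freq_not_rainbow:
  assumes "finite V" "T > 0" "K > 0" "s > 0" "W \<subseteq> V" "card W \<ge> K * (2 * s\<^sup>2)"
  shows "freq (labels V T K s) (\<lambda>y. \<not> rainbow s y W) \<le> 1 - 1 / (2 * real T)"
proof -
  let ?F = "V \<rightarrow>\<^sub>E {..<K * s}" and ?R = "\<lambda>f. \<forall>j<s. \<exists>v\<in>W. f v = j"
  have fin: "finite ?F" using assms by (simp add: finite_PiE)
  have ne: "?F \<noteq> {}" using assms by (auto simp: PiE_eq_empty_iff lessThan_empty_iff)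
  have ks: "{..<K * s} \<noteq> {}" using assms by (auto simp: lessThan_empty_iff)
  have "freq ?F (\<lambda>f. \<not> ?R f) \<le> freq ?F (\<lambda>f. \<exists>j\<in>{..<s}. \<forall>v\<in>W. f v \<noteq> j)"
    by (rule freq_mono[OF fin]) auto
  also have "\<dots> \<le> (\<Sum>j<s. freq ?F (\<lambda>f. \<forall>v\<in>W. f v \<noteq> j))"
    by (rule freq_Bex_le) simp
  also have "\<dots> \<le> (\<Sum>j<s. 1 / (2 * real s))"
  proof (rule sum_mono)
    fix j assume j: "j \<in> {..<s}"
    have "s \<le> K * s" using assms(3) by (cases K) auto
    then have "j < K * s" using j by (meson lessThan_iff less_le_trans)
    then have "freq {..<K * s} (\<lambda>c. c \<noteq> j) = 1 - 1 / real (K * s)"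
      using ks by (subst freq_not) (simp_all add: freq_lessThan_eq)
    then have "freq ?F (\<lambda>f. \<forall>v\<in>W. f v \<noteq> j) = (1 - 1 / real (K * s)) ^ card W"
      using assms by (subst freq_PiE[of V W _ "\<lambda>_ c. c \<noteq> j"]) (auto simp: lessThan_empty_iff)
    also have "\<dots> \<le> exp (- (1 / real (K * s))) ^ card W"
    proof (rule power_mono)
      show "1 - 1 / real (K * s) \<le> exp (- (1 / real (K * s)))"
        using exp_ge_add_one_self[of "- (1 / real (K * s))"] by simp
      have "real (K * s) \<ge> 1" using assms by (simp add: Suc_leI del: of_nat_mult)
      then show "0 \<le> 1 - 1 / real (K * s)" by (simp add: field_simps)
    qed
    also have "\<dots> = exp (- (real (card W) / real (K * s)))"
      by (simp add: exp_of_nat_mult[symmetric])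
    also have "\<dots> \<le> exp (- (2 * real s))"
    proof -
      have "real (card W) \<ge> real (K * (2 * s\<^sup>2))" using assms(6) by (rule of_nat_mono)
      then have "2 * real s \<le> real (card W) / real (K * s)"
        using assms by (simp add: field_simps power2_eq_square)
      then show ?thesis by simp
    qed
    also have "\<dots> \<le> 1 / (2 * real s)"
    proof -
      have "2 * real s \<le> exp (2 * real s)" using exp_ge_add_one_self[of "2 * real s"] by linarith
      then show ?thesis using assms by (simp add: exp_minus field_simps)
    qed
    finally show "freq ?F (\<lambda>f. \<forall>v\<in>W. f v \<noteq> j) \<le> 1 / (2 * real s)" .
  qed
  also have "\<dots> = 1 / 2" using assms by simp
  finally have "freq ?F ?R \<ge> 1 / 2" using freq_not[OF fin ne, of ?R] by linarith
  then have "1 / real T * (1 / 2) \<le> 1 / real T * freq ?F ?R"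
    by (intro mult_left_mono) auto
  also have "\<dots> = freq (labels V T K s) (\<lambda>y. rainbow s y W)"
    unfolding rainbow_def using assms by (subst freq_labels) auto
  finally show ?thesis
    using freq_not[OF finite_labels labels_nonempty, of V T K s "\<lambda>y. rainbow s y W"] assms by simp
qed

section \<open>Systems of lines\<close>

text \<open>Truncating an affine plane to \<open>n\<close> points removes points but no lines, so
  the number of points and the sizes of lines are only bounded above, while the number of lines and
  of lines through a point is exact. Two points may lie on no common line, as those on a vertical
  line do.\<close>

locale line_system =
  fixes V :: "'v set" and L :: "'l set" and pts :: "'l \<Rightarrow> 'v set" and q :: nat
  assumes finite_V: "finite V" and finite_L: "finite L"
    and card_V: "card V \<le> q\<^sup>2" and card_L: "card L = q\<^sup>2"
    and pts_subset: "l \<in> L \<Longrightarrow> pts l \<subseteq> V"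
    and card_pts: "l \<in> L \<Longrightarrow> card (pts l) \<le> q"
    and lines_through: "v \<in> V \<Longrightarrow> card {l \<in> L. v \<in> pts l} = q"
    and line_unique: "l \<in> L \<Longrightarrow> m \<in> L \<Longrightarrow> u \<noteq> v \<Longrightarrow> {u, v} \<subseteq> pts l \<Longrightarrow> {u, v} \<subseteq> pts m \<Longrightarrow> l = m"
    and q_pos: "q > 0"
begin

definition collinear :: "'v \<Rightarrow> 'v \<Rightarrow> bool" where
  "collinear u v \<longleftrightarrow> (\<exists>l\<in>L. {u, v} \<subseteq> pts l)"

text \<open>The argument is a set and not a pair, so that symmetry is built in and the edges of a
  clique can serve as indices of lines.\<close>

definition line_of :: "'v set \<Rightarrow> 'l" where
  "line_of e = (SOME l. l \<in> L \<and> e \<subseteq> pts l)"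

lemma line_of:
  assumes "collinear u v"
  shows "line_of {u, v} \<in> L" "u \<in> pts (line_of {u, v})" "v \<in> pts (line_of {u, v})"
proof -
  have "\<exists>l. l \<in> L \<and> {u, v} \<subseteq> pts l" using assms by (auto simp: collinear_def)
  from someI_ex[OF this]
  show "line_of {u, v} \<in> L" "u \<in> pts (line_of {u, v})" "v \<in> pts (line_of {u, v})"
    by (auto simp: line_of_def)
qed

lemma line_of_eq: "l \<in> L \<Longrightarrow> u \<noteq> v \<Longrightarrow> u \<in> pts l \<Longrightarrow> v \<in> pts l \<Longrightarrow> line_of {u, v} = l"
  using line_of[of u v] line_unique[of "line_of {u, v}" l u v] by (auto simp: collinear_def)

lemma finite_pts: "l \<in> L \<Longrightarrow> finite (pts l)"
  using pts_subset finite_V finite_subset by blast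

section \<open>Moments of the incidences of a vertex set\<close>

lemma sum_card_pts:
  assumes "W \<subseteq> V"
  shows "(\<Sum>l\<in>L. real (card (W \<inter> pts l))) = real q * real (card W)"
proof -
  have fW: "finite W" using assms finite_V finite_subset by blast
  have "(\<Sum>l\<in>L. real (card (W \<inter> pts l))) = (\<Sum>l\<in>L. \<Sum>v\<in>W. of_bool (v \<in> pts l))"
    using fW by (intro sum.cong) (auto simp: sum.If_cases of_bool_def)
  also have "\<dots> = (\<Sum>v\<in>W. \<Sum>l\<in>L. of_bool (v \<in> pts l))" by (rule sum.swap)
  also have "\<dots> = (\<Sum>v\<in>W. real q)"
  proof (rule sum.cong[OF refl])
    fix v assume "v \<in> W"
    then have "card {l \<in> L. v \<in> pts l} = q" using assms lines_through by blast
    then show "(\<Sum>l\<in>L. of_bool (v \<in> pts l)) = real q"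
      using finite_L by (simp add: sum.If_cases of_bool_def Int_def)
  qed
  finally show ?thesis by simp
qed

text \<open>Counts ordered pairs of \<open>W\<close> on a common line: the diagonal gives
  \<open>q\<close> for each point, and two distinct points share at most one line.\<close>

lemma sum_card_pts_squared:
  assumes "W \<subseteq> V"
  shows "(\<Sum>l\<in>L. (real (card (W \<inter> pts l)))\<^sup>2) \<le> real q * real (card W) + (real (card W))\<^sup>2"
proof -
  have fW: "finite W" using assms finite_V finite_subset by blast
  have "(real (card (W \<inter> pts l)))\<^sup>2 = (\<Sum>u\<in>W. \<Sum>v\<in>W. of_bool (u \<in> pts l \<and> v \<in> pts l))" for l
  proof -
    have "real (card (W \<inter> pts l)) = (\<Sum>v\<in>W. of_bool (v \<in> pts l))"
      using fW by (auto simp: sum.If_cases of_bool_def)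
    then show ?thesis
      by (simp add: power2_eq_square sum_product of_bool_conj)
  qed
  then have "(\<Sum>l\<in>L. (real (card (W \<inter> pts l)))\<^sup>2)
      = (\<Sum>l\<in>L. \<Sum>u\<in>W. \<Sum>v\<in>W. of_bool (u \<in> pts l \<and> v \<in> pts l))"
    by simp
  also have "\<dots> = (\<Sum>u\<in>W. \<Sum>l\<in>L. \<Sum>v\<in>W. of_bool (u \<in> pts l \<and> v \<in> pts l))"
    by (rule sum.swap)
  also have "\<dots> = (\<Sum>u\<in>W. \<Sum>v\<in>W. \<Sum>l\<in>L. of_bool (u \<in> pts l \<and> v \<in> pts l))"
    by (intro sum.cong refl sum.swap)
  also have "\<dots> \<le> (\<Sum>u\<in>W. \<Sum>v\<in>W. (if u = v then real q else 0) + 1)"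
  proof (intro sum_mono)
    fix u v assume uv: "u \<in> W" "v \<in> W"
    have eq: "(\<Sum>l\<in>L. of_bool (u \<in> pts l \<and> v \<in> pts l)) = real (card {l \<in> L. u \<in> pts l \<and> v \<in> pts l})"
      using finite_L by (simp add: sum.If_cases of_bool_def Int_def)
    show "(\<Sum>l\<in>L. of_bool (u \<in> pts l \<and> v \<in> pts l)) \<le> (if u = v then real q else 0) + 1"
    proof (cases "u = v")
      case True
      then show ?thesis using eq lines_through[of v] uv assms by auto
    next
      case False
      have "card {l \<in> L. u \<in> pts l \<and> v \<in> pts l} \<le> card {line_of {u, v}}"
        using False line_of_eq by (intro card_mono) auto
      then show ?thesis using eq False by simp
    qed
  qed
  also have "\<dots> = real q * real (card W) + (real (card W))\<^sup>2"
    using fW by (simp add: sum.distrib power2_eq_square algebra_simps)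
  finally show ?thesis .
qed

text \<open>A Paley-Zygmund argument. The mean of \<open>card (W \<inter> pts l)\<close> over all
  lines is \<open>2 * k\<close>, so lines below \<open>k\<close> carry at most half of the
  incidences, and the second moment prevents the other half from being concentrated on fewer than
  \<open>q^2 / 8\<close> lines.\<close>

lemma many_rich_lines:
  assumes "W \<subseteq> V" "card W = 2 * q * k" "k > 0"
  shows "real q ^ 2 \<le> 8 * real (card {l \<in> L. k \<le> card (W \<inter> pts l)})"
proof -
  let ?G = "{l \<in> L. k \<le> card (W \<inter> pts l)}" and ?a = "\<lambda>l. real (card (W \<inter> pts l))"
  define w where "w = real (card W)"
  have w: "w = 2 * real q * real k" using assms by (simp add: w_def)
  have wq: "w \<ge> real q" using assms(3) q_pos by (simp add: w)
  have q0: "real q > 0" using q_pos by simp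
  have w0: "w > 0" using wq q0 by linarith
  have "real q * w = (\<Sum>l\<in>L. ?a l)" using sum_card_pts[OF assms(1)] by (simp add: w_def)
  also have "\<dots> = (\<Sum>l\<in>L - ?G. ?a l) + (\<Sum>l\<in>?G. ?a l)"
    using finite_L by (intro sum.subset_diff) auto
  also have "(\<Sum>l\<in>L - ?G. ?a l) \<le> (\<Sum>l\<in>L. real k)"
  proof -
    have "(\<Sum>l\<in>L - ?G. ?a l) \<le> (\<Sum>l\<in>L - ?G. real k)" by (intro sum_mono) auto
    also have "\<dots> \<le> (\<Sum>l\<in>L. real k)" using finite_L by (intro sum_mono2) auto
    finally show ?thesis .
  qed
  also have "(\<Sum>l\<in>L. real k) = real q * w / 2" using card_L by (simp add: w power2_eq_square)
  finally have 1: "real q * w / 2 \<le> (\<Sum>l\<in>?G. ?a l)" by simp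
  \<comment> \<open>Cauchy-Schwarz, linearised by AM-GM with weight \<open>q / (8 w)\<close>.\<close>
  have "(\<Sum>l\<in>?G. ?a l) \<le> (\<Sum>l\<in>?G. real q / (8 * w) * (?a l)\<^sup>2 + 2 * w / real q)"
  proof (rule sum_mono)
    fix l
    have "0 \<le> (real q * ?a l - 4 * w)\<^sup>2 / (8 * w * real q)" using w0 q0 by simp
    also have "\<dots> = real q / (8 * w) * (?a l)\<^sup>2 + 2 * w / real q - ?a l"
      using w0 q0 by (simp add: power2_eq_square field_simps)
    finally show "?a l \<le> real q / (8 * w) * (?a l)\<^sup>2 + 2 * w / real q" by simp
  qed
  also have "\<dots> = real q / (8 * w) * (\<Sum>l\<in>?G. (?a l)\<^sup>2) + 2 * w / real q * real (card ?G)"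
    by (simp add: sum.distrib sum_distrib_left)
  also have "(\<Sum>l\<in>?G. (?a l)\<^sup>2) \<le> (\<Sum>l\<in>L. (?a l)\<^sup>2)"
    using finite_L by (intro sum_mono2) auto
  also have "(\<Sum>l\<in>L. (?a l)\<^sup>2) \<le> real q * w + w\<^sup>2"
    using sum_card_pts_squared[OF assms(1)] by (simp add: w_def)
  \<comment> \<open>Here the size \<open>2 * q * k \<ge> q\<close> matters: the diagonal term
    \<open>q * w\<close> is absorbed by the square of \<open>w\<close>.\<close>
  also have "real q * w + w\<^sup>2 \<le> 2 * w\<^sup>2" using wq w0 by (simp add: power2_eq_square)
  also have "real q / (8 * w) * (2 * w\<^sup>2) = real q * w / 4"
    using w0 by (simp add: power2_eq_square field_simps)
  finally have "(\<Sum>l\<in>?G. ?a l) \<le> real q * w / 4 + 2 * w / real q * real (card ?G)"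
    using w0 q0 by (simp add: mult_left_mono divide_right_mono)
  then have "real q * w / 2 \<le> real q * w / 4 + 2 * w / real q * real (card ?G)"
    using 1 by linarith
  then have "w * (real q)\<^sup>2 \<le> w * (8 * real (card ?G))"
    using w0 q0 by (simp add: field_simps power2_eq_square)
  then show ?thesis using w0 by (simp add: mult_le_cancel_left_pos)
qed

text \<open>Greedy choice: \<open>k\<close> chosen points determine at most \<open>k * k\<close>
  lines, each with at most \<open>M\<close> points of \<open>U\<close>. While \<open>U\<close> has
  more than \<open>k + k * k * M\<close> points, some unchosen point lies off all these
  lines.\<close>

lemma general_position:
  assumes "U \<subseteq> V" "\<And>l. l \<in> L \<Longrightarrow> card (U \<inter> pts l) \<le> M" "card U > k + k * k * M"
  shows "\<exists>Z\<subseteq>U. card Z = k \<and> (\<forall>l\<in>L. card (Z \<inter> pts l) \<le> 2)"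
  using assms(3)
proof (induction k)
  case 0
  then show ?case by (intro exI[of _ "{}"]) auto
next
  case (Suc k)
  have fU: "finite U" using assms(1) finite_V finite_subset by blast
  have "k + k * k * M \<le> Suc k + Suc k * Suc k * M"
    by (intro add_mono mult_right_mono mult_mono) auto
  then obtain Z where Z: "Z \<subseteq> U" "card Z = k" "\<forall>l\<in>L. card (Z \<inter> pts l) \<le> 2"
    using Suc by auto
  have fZ: "finite Z" using Z fU finite_subset by blast
  define S where "S = {l \<in> L. card (Z \<inter> pts l) \<ge> 2}"
  have "S \<subseteq> (\<lambda>(u, v). line_of {u, v}) ` (Z \<times> Z)"
  proof
    fix l assume l: "l \<in> S"
    then have "card (Z \<inter> pts l) > 1" by (simp add: S_def)
    then obtain u v where "u \<in> Z \<inter> pts l" "v \<in> Z \<inter> pts l" "u \<noteq> v"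
      by (metis card_le_Suc0_iff_eq card.infinite fZ finite_Int not_less One_nat_def)
    moreover from this have "l = line_of {u, v}" using l by (auto simp: S_def line_of_eq)
    ultimately show "l \<in> (\<lambda>(u, v). line_of {u, v}) ` (Z \<times> Z)" by auto
  qed
  then have "card S \<le> card (Z \<times> Z)"
    using fZ by (meson card_image_le card_mono finite_SigmaI finite_imageI le_trans)
  then have cS: "card S \<le> k * k" using Z by (simp add: card_cartesian_product)
  have fS: "finite S" using finite_L by (simp add: S_def)
  have "card (\<Union>l\<in>S. U \<inter> pts l) \<le> (\<Sum>l\<in>S. card (U \<inter> pts l))" by (rule card_UN_le[OF fS])
  also have "\<dots> \<le> (\<Sum>l\<in>S. M)" using assms(2) by (intro sum_mono) (auto simp: S_def)
  also have "\<dots> \<le> k * k * M" using cS by simp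
  finally have "card (Z \<union> (\<Union>l\<in>S. U \<inter> pts l)) \<le> k + k * k * M"
    using Z card_Un_le[of Z "\<Union>l\<in>S. U \<inter> pts l"] by linarith
  then have "card (Z \<union> (\<Union>l\<in>S. U \<inter> pts l)) < card U"
    using Suc.prems \<open>k + k * k * M \<le> _\<close> by linarith
  moreover have "finite (Z \<union> (\<Union>l\<in>S. U \<inter> pts l))" using fZ fS fU by auto
  ultimately have "\<not> U \<subseteq> Z \<union> (\<Union>l\<in>S. U \<inter> pts l)" by (meson card_mono leD)
  then obtain z where z: "z \<in> U" "z \<notin> Z" "\<And>l. l \<in> S \<Longrightarrow> z \<notin> pts l"
    by blast
  have "card (insert z Z \<inter> pts l) \<le> 2" if "l \<in> L" for l
  proof (cases "z \<in> pts l")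
    case True
    then have "card (Z \<inter> pts l) \<le> 1" using z that by (force simp: S_def)
    then show ?thesis using True z fZ by simp
  next
    case False
    then show ?thesis using Z that by simp
  qed
  then show ?case using Z z fZ by (intro exI[of _ "insert z Z"]) auto
qed

text \<open>Joins to different points of \<open>Y\<close> cannot agree, since a common line would be
  \<open>l\<close>, which misses \<open>X\<close>. Joins of \<open>x\<close> and \<open>x'\<close>
  to the same \<open>y\<close> agree only where the line through \<open>x\<close> and
  \<open>x'\<close> meets \<open>l\<close>, so each of the \<open>r * r\<close> ordered pairs spoils
  at most one point of \<open>Y\<close>.\<close>

lemma distinct_joining_lines:
  assumes "l \<in> L" "Y \<subseteq> pts l" "X \<subseteq> V" "X \<inter> pts l = {}" "card X = r"
    and "\<And>x y. x \<in> X \<Longrightarrow> y \<in> Y \<Longrightarrow> collinear x y" "card Y \<ge> M + r * r"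
  shows "\<exists>Y'\<subseteq>Y. card Y' = M \<and> inj_on (\<lambda>(x, y). line_of {x, y}) (X \<times> Y')"
proof -
  have fX: "finite X" using assms finite_V finite_subset by blast
  have fY: "finite Y" using assms finite_pts finite_subset by blast
  define B where "B = (\<lambda>(x, x'). {y \<in> Y. x \<noteq> x' \<and> line_of {x, y} = line_of {x', y}})"
  have B1: "card (B p) \<le> 1" if p: "p \<in> X \<times> X" for p
  proof -
    obtain x x' where xx: "p = (x, x')" "x \<in> X" "x' \<in> X" using p by auto
    have "y = y'" if y: "y \<in> B p" "y' \<in> B p" for y y'
    proof (rule ccontr)
      assume ne: "y \<noteq> y'"
      have yY: "y \<in> Y" "y' \<in> Y" and x: "x \<noteq> x'"
        and eq: "line_of {x, y} = line_of {x', y}" "line_of {x, y'} = line_of {x', y'}"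
        using y xx by (auto simp: B_def)
      note c = line_of[OF assms(6)]
      have "x' \<in> pts (line_of {x, y})" "x' \<in> pts (line_of {x, y'})"
        using c(2)[OF xx(3) yY(1)] c(2)[OF xx(3) yY(2)] eq by simp_all
      then have "line_of {x, x'} = line_of {x, y}" "line_of {x, x'} = line_of {x, y'}"
        using c(1,2)[OF xx(2) yY(1)] c(1,2)[OF xx(2) yY(2)] x by (auto intro: line_of_eq)
      then have "line_of {y, y'} = line_of {x, y}"
        using c[OF xx(2) yY(1)] c(3)[OF xx(2) yY(2)] ne by (intro line_of_eq) auto
      moreover have "line_of {y, y'} = l" using assms(1,2) yY ne line_of_eq by blast
      ultimately show False using c(2)[OF xx(2) yY(1)] xx assms(4) by auto
    qed
    moreover have "finite (B p)" using fY by (auto simp: B_def split: prod.split)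
    ultimately show ?thesis by (metis One_nat_def card_le_Suc0_iff_eq)
  qed
  have "card (\<Union>p\<in>X \<times> X. B p) \<le> (\<Sum>p\<in>X \<times> X. card (B p))" using fX by (intro card_UN_le) auto
  also have "\<dots> \<le> (\<Sum>p\<in>X \<times> X. 1)" using B1 by (rule sum_mono)
  also have "\<dots> = r * r" using assms(5) by (simp add: card_cartesian_product)
  finally have "card (\<Union>p\<in>X \<times> X. B p) \<le> r * r" .
  moreover have "(\<Union>p\<in>X \<times> X. B p) \<subseteq> Y" by (auto simp: B_def)
  ultimately have "card (Y - (\<Union>p\<in>X \<times> X. B p)) \<ge> M"
    using assms(7) fY by (simp add: card_Diff_subset finite_subset)
  then obtain Y' where Y': "Y' \<subseteq> Y - (\<Union>p\<in>X \<times> X. B p)" "card Y' = M"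
    by (meson obtain_subset_with_card_n)
  have "inj_on (\<lambda>(x, y). line_of {x, y}) (X \<times> Y')"
  proof (rule inj_onI, clarify)
    fix x y x' y' assume h: "x \<in> X" "y \<in> Y'" "x' \<in> X" "y' \<in> Y'" "line_of {x, y} = line_of {x', y'}"
    then have yY: "y \<in> Y" "y' \<in> Y" using Y' by auto
    note c = line_of[OF assms(6)]
    have "y = y'"
    proof (rule ccontr)
      assume ne: "y \<noteq> y'"
      then have "line_of {y, y'} = line_of {x, y}"
        using c[OF h(1) yY(1)] c(3)[OF h(3) yY(2)] h(5) by (intro line_of_eq) auto
      moreover have "line_of {y, y'} = l" using assms(1,2) yY ne line_of_eq by blast
      ultimately show False using c(2)[OF h(1) yY(1)] h assms(4) by auto
    qed
    moreover from this have "x = x'" using h Y' yY by (auto simp: B_def)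
    ultimately show "x = x' \<and> y = y'" by simp
  qed
  then show ?thesis using Y' by blast
qed

end

section \<open>The random graph of a line system\<close>

lemma card_subsets_le:
  assumes "finite A" "card A \<le> N"
  shows "card {B. B \<subseteq> A \<and> card B = k} \<le> N ^ k"
proof (cases "k \<le> card A")
  case True
  have "card {B. B \<subseteq> A \<and> card B = k} \<le> card A ^ k"
    using True assms(1) by (simp add: n_subsets binomial_le_pow)
  also have "\<dots> \<le> N ^ k" using assms(2) by (rule power_mono) simp
  finally show ?thesis .
next
  case False
  then show ?thesis using assms(1) by (simp add: n_subsets binomial_eq_0)
qed

locale random_lines = line_system V L pts q
  for V :: "'v set" and L :: "'l set" and pts :: "'l \<Rightarrow> 'v set" and q :: nat +
  fixes T K s :: nat
  assumes T_pos: "T > 0" and K_pos: "K > 0" and s_ge: "s \<ge> 2"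
begin

abbreviation Y where "Y \<equiv> labels V T K s"

definition outcomes :: "('l \<Rightarrow> nat \<times> ('v \<Rightarrow> nat)) set" where
  "outcomes = L \<rightarrow>\<^sub>E Y"

definition adjacent :: "('l \<Rightarrow> nat \<times> ('v \<Rightarrow> nat)) \<Rightarrow> 'v \<Rightarrow> 'v \<Rightarrow> bool" where
  "adjacent \<omega> u v \<longleftrightarrow> (\<exists>l\<in>L. {u, v} \<subseteq> pts l \<and> joined s (\<omega> l) u v)"

lemma finite_Y: "finite Y"
  using finite_labels[OF finite_V] .

lemma Y_nonempty: "Y \<noteq> {}"
  using labels_nonempty[of T K s V] T_pos K_pos s_ge by linarith

lemma finite_outcomes: "finite outcomes" and outcomes_nonempty: "outcomes \<noteq> {}"
  using finite_L finite_Y Y_nonempty by (auto simp: outcomes_def finite_PiE PiE_eq_empty_iff)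

lemma freq_outcomes:
  "S \<subseteq> L \<Longrightarrow> freq outcomes (\<lambda>\<omega>. \<forall>l\<in>S. P l (\<omega> l)) = (\<Prod>l\<in>S. freq Y (P l))"
  unfolding outcomes_def by (rule freq_PiE[OF finite_L _ finite_Y Y_nonempty])

lemma adjacent_sym: "adjacent \<omega> u v \<Longrightarrow> adjacent \<omega> v u"
  by (auto simp: adjacent_def joined_def)

lemma adjacent_irrefl: "\<not> adjacent \<omega> u u"
  by (auto simp: adjacent_def joined_def)

lemma adjacent_in_V: "adjacent \<omega> u v \<Longrightarrow> u \<in> V \<and> v \<in> V"
  using pts_subset by (auto simp: adjacent_def)

lemma adjacent_collinear: "adjacent \<omega> u v \<Longrightarrow> collinear u v"
  by (auto simp: adjacent_def collinear_def)

text \<open>Two distinct points lie on at most one line, so an edge gives information on the label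
  of any line known to pass through its ends.\<close>

lemma adjacent_joined:
  assumes "adjacent \<omega> u v" "l \<in> L" "u \<in> pts l" "v \<in> pts l"
  shows "joined s (\<omega> l) u v"
proof -
  obtain m where m: "m \<in> L" "{u, v} \<subseteq> pts m" "joined s (\<omega> m) u v"
    using assms(1) unfolding adjacent_def by blast
  then have "u \<noteq> v" by (auto simp: joined_def)
  then have "l = m" using m assms by (intro line_unique[of l m u v]) auto
  then show ?thesis using m by simp
qed

section \<open>Expected number of edges\<close>

lemma freq_adjacent:
  assumes "collinear u v" "u \<noteq> v"
  shows "freq outcomes (\<lambda>\<omega>. adjacent \<omega> u v) \<ge> 1 / (2 * real T * real K)"
proof -
  let ?l = "line_of {u, v}"
  note l = line_of[OF assms(1)]
  have uv: "u \<in> V" "v \<in> V" using l pts_subset by auto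
  have "1 / (2 * real T * real K) \<le> freq Y (\<lambda>y. joined s y u v)"
    using freq_joined[OF finite_V T_pos K_pos s_ge uv assms(2)] .
  also have "\<dots> = freq outcomes (\<lambda>\<omega>. \<forall>l\<in>{?l}. joined s (\<omega> l) u v)"
    using l(1) by (subst freq_outcomes) auto
  also have "\<dots> \<le> freq outcomes (\<lambda>\<omega>. adjacent \<omega> u v)"
    using l by (intro freq_mono finite_outcomes) (auto simp: adjacent_def)
  finally show ?thesis .
qed

lemma sum_adjacent:
  "(\<Sum>\<omega>\<in>outcomes. real (card {(u, v) \<in> V \<times> V. adjacent \<omega> u v}))
   \<ge> real (card {(u, v) \<in> V \<times> V. collinear u v \<and> u \<noteq> v}) / (2 * real T * real K) * real (card outcomes)"
proof -
  let ?D = "{(u, v) \<in> V \<times> V. collinear u v \<and> u \<noteq> v}"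
  have D: "?D \<subseteq> V \<times> V" "finite ?D"
    using finite_V by (auto intro: finite_subset[of _ "V \<times> V"])
  have "(\<Sum>\<omega>\<in>outcomes. real (card {(u, v) \<in> V \<times> V. adjacent \<omega> u v}))
      = (\<Sum>\<omega>\<in>outcomes. \<Sum>p\<in>V \<times> V. of_bool (adjacent \<omega> (fst p) (snd p)))"
    using finite_V by (intro sum.cong) (auto simp: of_bool_def sum.If_cases Int_def intro!: arg_cong[of _ _ card])
  also have "\<dots> = (\<Sum>p\<in>V \<times> V. \<Sum>\<omega>\<in>outcomes. of_bool (adjacent \<omega> (fst p) (snd p)))"
    by (rule sum.swap)
  also have "\<dots> \<ge> (\<Sum>p\<in>?D. \<Sum>\<omega>\<in>outcomes. of_bool (adjacent \<omega> (fst p) (snd p)))"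
    using D finite_V by (intro sum_mono2) (auto intro!: sum_nonneg)
  also have "(\<Sum>p\<in>?D. \<Sum>\<omega>\<in>outcomes. of_bool (adjacent \<omega> (fst p) (snd p)) :: real)
      = (\<Sum>p\<in>?D. freq outcomes (\<lambda>\<omega>. adjacent \<omega> (fst p) (snd p)) * real (card outcomes))"
    using finite_outcomes outcomes_nonempty
    by (intro sum.cong) (auto simp: of_bool_def sum.If_cases Int_def freq_def)
  also have "\<dots> \<ge> (\<Sum>p\<in>?D. 1 / (2 * real T * real K) * real (card outcomes))"
    by (intro sum_mono mult_right_mono) (auto intro!: freq_adjacent)
  finally show ?thesis by simp
qed

text \<open>Labels of distinct lines are independent, so injectivity of \<open>h\<close> makes the
  joint event a product. Scattered sets and cones are pruned to have distinct lines for the sake of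
  this bound.\<close>

lemma freq_same_blocks:
  assumes "finite J" "inj_on h J" "h ` J \<subseteq> L"
    and "\<And>j. j \<in> J \<Longrightarrow> U j \<subseteq> V" "\<And>j. j \<in> J \<Longrightarrow> U j \<noteq> {}"
  shows "freq outcomes (\<lambda>\<omega>. \<forall>j\<in>J. same_block s (\<omega> (h j)) (U j))
         \<le> (\<Prod>j\<in>J. 1 / real T * (1 / real K) ^ (card (U j) - 1))"
proof -
  have "freq outcomes (\<lambda>\<omega>. \<forall>j\<in>J. same_block s (\<omega> (h j)) (U j))
      = freq outcomes (\<lambda>\<omega>. \<forall>l\<in>h ` J. same_block s (\<omega> l) (U (the_inv_into J h l)))"
    using assms(2) by (intro freq_cong) (auto simp: the_inv_into_f_f)
  also have "\<dots> = (\<Prod>l\<in>h ` J. freq Y (\<lambda>y. same_block s y (U (the_inv_into J h l))))"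
    using assms(3) by (rule freq_outcomes)
  also have "\<dots> = (\<Prod>j\<in>J. freq Y (\<lambda>y. same_block s y (U j)))"
    using assms(2) by (subst prod.reindex) (auto simp: the_inv_into_f_f intro!: prod.cong)
  also have "\<dots> \<le> (\<Prod>j\<in>J. 1 / real T * (1 / real K) ^ (card (U j) - 1))"
    using assms(4,5) finite_V T_pos K_pos s_ge
    by (intro prod_mono conjI freq_nonneg freq_same_block) auto
  finally show ?thesis .
qed

text \<open>A clique on \<open>s + r\<close> vertices has at most \<open>s\<close> of them on any line. So either some line carries many of
  them and \<open>r\<close> more lie off that line (a cone), or a greedy choice finds many in general position. In both
  configurations the number of distinct lines involved makes the expected number of occurrences tiny.\<close>

definition scattered_sets :: "nat \<Rightarrow> 'v set set" where
  "scattered_sets k = {Z. Z \<subseteq> V \<and> card Z = k \<and> (\<forall>u\<in>Z. \<forall>v\<in>Z. u \<noteq> v \<longrightarrow> collinear u v) \<and>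
     (\<forall>l\<in>L. card (Z \<inter> pts l) \<le> 2)}"

definition scattered_clique :: "nat \<Rightarrow> ('l \<Rightarrow> nat \<times> ('v \<Rightarrow> nat)) \<Rightarrow> bool" where
  "scattered_clique k \<omega> \<longleftrightarrow> (\<exists>Z\<in>scattered_sets k. \<forall>e\<in>{e. e \<subseteq> Z \<and> card e = 2}. same_block s (\<omega> (line_of e)) e)"

text \<open>Union bound over at most \<open>q ^ (2 * k)\<close> sets. The pairs of a scattered set
  lie on \<open>k choose 2\<close> different lines, each costing \<open>1 / (T * K)\<close>, and
  this quadratic exponent wins for large \<open>k\<close>.\<close>

lemma freq_scattered_clique:
  "freq outcomes (scattered_clique k) \<le> real q ^ (2 * k) * (1 / real (T * K)) ^ (k choose 2)"
proof -
  have sub: "scattered_sets k \<subseteq> {Z. Z \<subseteq> V \<and> card Z = k}" by (auto simp: scattered_sets_def)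
  have fin: "finite (scattered_sets k)"
    using finite_V sub by (auto intro: finite_subset[of _ "Pow V"])
  have "card (scattered_sets k) \<le> card {Z. Z \<subseteq> V \<and> card Z = k}"
    using sub finite_V by (intro card_mono) auto
  also have "\<dots> \<le> (q\<^sup>2) ^ k" using card_subsets_le[OF finite_V card_V] .
  finally have "real (card (scattered_sets k)) \<le> real ((q\<^sup>2) ^ k)" by (rule of_nat_mono)
  then have c: "real (card (scattered_sets k)) \<le> real q ^ (2 * k)" by (simp add: power_mult)
  have "freq outcomes (scattered_clique k) \<le> (\<Sum>Z\<in>scattered_sets k.
      freq outcomes (\<lambda>\<omega>. \<forall>e\<in>{e. e \<subseteq> Z \<and> card e = 2}. same_block s (\<omega> (line_of e)) e))"
    unfolding scattered_clique_def by (rule freq_Bex_le[OF fin])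
  also have "\<dots> \<le> (\<Sum>Z\<in>scattered_sets k. (1 / real (T * K)) ^ (k choose 2))"
  proof (rule sum_mono)
    fix Z assume "Z \<in> scattered_sets k"
    then have Z: "Z \<subseteq> V" "card Z = k" "\<And>u v. u \<in> Z \<Longrightarrow> v \<in> Z \<Longrightarrow> u \<noteq> v \<Longrightarrow> collinear u v"
      "\<And>l. l \<in> L \<Longrightarrow> card (Z \<inter> pts l) \<le> 2" by (auto simp: scattered_sets_def)
    have fZ: "finite Z" using Z finite_V finite_subset by blast
    let ?J = "{e. e \<subseteq> Z \<and> card e = 2}"
    have fJ: "finite ?J" using fZ by auto
    have J: "line_of e \<in> L \<and> e \<subseteq> pts (line_of e)" if e: "e \<in> ?J" for e
    proof -
      obtain u v where "e = {u, v}" "u \<noteq> v" using e by (auto simp: card_2_iff)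
      then show ?thesis using line_of[of u v] Z(3) e by auto
    qed
    \<comment> \<open>No third point of \<open>Z\<close> lies on the line of \<open>e\<close>, so
      \<open>e\<close> can be read off its line; this is the injectivity that independence asks
      for.\<close>
    have eq: "e = Z \<inter> pts (line_of e)" if e: "e \<in> ?J" for e
    proof (rule card_seteq)
      show "finite (Z \<inter> pts (line_of e))" using fZ by simp
      show "e \<subseteq> Z \<inter> pts (line_of e)" using J[OF e] e by auto
      show "card (Z \<inter> pts (line_of e)) \<le> card e" using Z(4) J[OF e] e by auto
    qed
    have "inj_on line_of ?J" by (rule inj_onI) (metis eq)
    then have "freq outcomes (\<lambda>\<omega>. \<forall>e\<in>?J. same_block s (\<omega> (line_of e)) e)
        \<le> (\<Prod>e\<in>?J. 1 / real T * (1 / real K) ^ (card e - 1))"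
      using fJ J Z(1) by (intro freq_same_blocks) auto
    also have "\<dots> = (\<Prod>e\<in>?J. 1 / real (T * K))" by (intro prod.cong) auto
    also have "\<dots> = (1 / real (T * K)) ^ (k choose 2)"
      using n_subsets[OF fZ, of 2] Z(2) by simp
    finally show "freq outcomes (\<lambda>\<omega>. \<forall>e\<in>?J. same_block s (\<omega> (line_of e)) e) \<le> (1 / real (T * K)) ^ (k choose 2)" .
  qed
  also have "\<dots> = real (card (scattered_sets k)) * (1 / real (T * K)) ^ (k choose 2)" by simp
  also have "\<dots> \<le> real q ^ (2 * k) * (1 / real (T * K)) ^ (k choose 2)"
    using c by (rule mult_right_mono) simp
  finally show ?thesis .
qed

text \<open>The joining lines differ from one another and, as \<open>X\<close> avoids
  \<open>pts l\<close>, also from \<open>l\<close>, so a cone involves \<open>1 + r * M\<close>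
  independent labels.\<close>

definition cones :: "nat \<Rightarrow> nat \<Rightarrow> ('l \<times> 'v set \<times> 'v set) set" where
  "cones M r = {(l, B, X). l \<in> L \<and> B \<subseteq> pts l \<and> card B = M \<and> X \<subseteq> V \<and> card X = r \<and> X \<inter> pts l = {} \<and>
     (\<forall>x\<in>X. \<forall>y\<in>B. collinear x y) \<and> inj_on (\<lambda>(x, y). line_of {x, y}) (X \<times> B)}"

definition cone_clique :: "nat \<Rightarrow> nat \<Rightarrow> ('l \<Rightarrow> nat \<times> ('v \<Rightarrow> nat)) \<Rightarrow> bool" where
  "cone_clique M r \<omega> \<longleftrightarrow> (\<exists>(l, B, X)\<in>cones M r. same_block s (\<omega> l) B \<and>
     (\<forall>x\<in>X. \<forall>y\<in>B. same_block s (\<omega> (line_of {x, y})) {x, y}))"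

text \<open>Choosing the line costs \<open>q^2\<close>, each apex \<open>q^2\<close>, but each base
  point only \<open>q\<close>, because it is taken from one line. This last factor is what
  \<open>K * (T * K) ^ r\<close> has to outweigh.\<close>

lemma freq_cone_clique:
  assumes "M > 0"
  shows "freq outcomes (cone_clique M r)
         \<le> real q ^ (2 + M + 2 * r) * ((1 / real T) * (1 / real K) ^ (M - 1) * (1 / real (T * K)) ^ (r * M))"
    (is "_ \<le> _ * ?p")
proof -
  let ?S = "Sigma L (\<lambda>l. {B. B \<subseteq> pts l \<and> card B = M} \<times> {X. X \<subseteq> V \<and> card X = r})"
  have sub: "cones M r \<subseteq> ?S" by (auto simp: cones_def)
  have fin_pts: "finite {B. B \<subseteq> pts l \<and> card B = M}" if "l \<in> L" for l
    using finite_pts[OF that] by simp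
  have fin_V: "finite {X. X \<subseteq> V \<and> card X = r}" using finite_V by simp
  have finS: "finite ?S"
    using fin_pts fin_V finite_L by (blast intro: finite_SigmaI finite_cartesian_product)
  have fin: "finite (cones M r)" by (rule finite_subset[OF sub finS])
  have "card (cones M r) \<le> card ?S" by (rule card_mono[OF finS sub])
  also have "\<dots> = (\<Sum>l\<in>L. card {B. B \<subseteq> pts l \<and> card B = M} * card {X. X \<subseteq> V \<and> card X = r})"
    using finite_L fin_V fin_pts by (subst card_SigmaI) (blast intro: finite_cartesian_product | simp add: card_cartesian_product)+
  also have "\<dots> \<le> (\<Sum>l\<in>L. q ^ M * (q\<^sup>2) ^ r)"
    using card_pts finite_pts finite_V card_V
    by (intro sum_mono mult_mono card_subsets_le) auto
  also have "\<dots> = q ^ (2 + M + 2 * r)" using card_L by (simp add: power_add power_mult power2_eq_square)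
  finally have "real (card (cones M r)) \<le> real (q ^ (2 + M + 2 * r))" by (rule of_nat_mono)
  then have c: "real (card (cones M r)) \<le> real q ^ (2 + M + 2 * r)" by simp
  have "freq outcomes (cone_clique M r) \<le> (\<Sum>p\<in>cones M r. freq outcomes (\<lambda>\<omega>.
      case p of (l, B, X) \<Rightarrow> same_block s (\<omega> l) B \<and>
     (\<forall>x\<in>X. \<forall>y\<in>B. same_block s (\<omega> (line_of {x, y})) {x, y})))"
    unfolding cone_clique_def by (rule freq_Bex_le[OF fin])
  also have "\<dots> \<le> (\<Sum>p\<in>cones M r. ?p)"
  proof (rule sum_mono)
    fix p assume "p \<in> cones M r"
    moreover obtain l B X where p: "p = (l, B, X)" by (cases p)
    ultimately have c: "l \<in> L" "B \<subseteq> pts l" "card B = M" "X \<subseteq> V" "card X = r" "X \<inter> pts l = {}"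
      "\<And>x y. x \<in> X \<Longrightarrow> y \<in> B \<Longrightarrow> collinear x y" "inj_on (\<lambda>(x, y). line_of {x, y}) (X \<times> B)"
      by (auto simp: cones_def)
    have fin: "finite X" "finite B" using c finite_V finite_pts finite_subset by blast+
    have BV: "B \<subseteq> V" using c pts_subset by blast
    \<comment> \<open>The lines of the cone are indexed by an option type: \<open>None\<close> is
      the line \<open>l\<close> with its base \<open>B\<close>, and \<open>Some (x, y)\<close> is a
      joining line with its pair.\<close>
    define h where "h = case_option l (\<lambda>(x, y). line_of {x, y})"
    define U where "U = case_option B (\<lambda>(x, y). {x, y})"
    let ?J = "insert None (Some ` (X \<times> B))"
    have hL: "h ` ?J \<subseteq> L" using c(1) line_of[OF c(7)] by (auto simp: h_def)
    have ne: "line_of {x, y} \<noteq> l" if "x \<in> X" "y \<in> B" for x y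
      using line_of(2)[OF c(7)[OF that]] c(6) that by auto
    have inj: "inj_on h ?J"
      using c(8) ne by (auto simp: h_def inj_on_def) (metis (no_types, lifting))+
    have "freq outcomes (\<lambda>\<omega>. case p of (l, B, X) \<Rightarrow> same_block s (\<omega> l) B \<and>
       (\<forall>x\<in>X. \<forall>y\<in>B. same_block s (\<omega> (line_of {x, y})) {x, y}))
      = freq outcomes (\<lambda>\<omega>. \<forall>j\<in>?J. same_block s (\<omega> (h j)) (U j))"
      by (intro freq_cong) (auto simp: h_def U_def p)
    also have "\<dots> \<le> (\<Prod>j\<in>?J. 1 / real T * (1 / real K) ^ (card (U j) - 1))"
      using fin inj hL c(3,4) BV assms by (intro freq_same_blocks) (auto simp: U_def)
    also have "\<dots> = 1 / real T * (1 / real K) ^ (M - 1) *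
        (\<Prod>p\<in>X \<times> B. 1 / real T * (1 / real K) ^ (card (U (Some p)) - 1))"
      using fin c(3) by (simp add: prod.reindex U_def)
    also have "(\<Prod>p\<in>X \<times> B. 1 / real T * (1 / real K) ^ (card (U (Some p)) - 1)) = (\<Prod>p\<in>X \<times> B. 1 / real (T * K))"
    proof (rule prod.cong[OF refl])
      fix p assume p: "p \<in> X \<times> B"
      then have "fst p \<noteq> snd p" using c(2,6) by auto
      then have "card (U (Some p)) = 2" by (cases p) (simp add: U_def)
      then show "1 / real T * (1 / real K) ^ (card (U (Some p)) - 1) = 1 / real (T * K)" by simp
    qed
    also have "\<dots> = (1 / real (T * K)) ^ (r * M)"
      using c by (simp add: card_cartesian_product)
    finally show "freq outcomes (\<lambda>\<omega>. case p of (l, B, X) \<Rightarrow> same_block s (\<omega> l) B \<and>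
       (\<forall>x\<in>X. \<forall>y\<in>B. same_block s (\<omega> (line_of {x, y})) {x, y})) \<le> ?p" .
  qed
  also have "\<dots> = real (card (cones M r)) * ?p" by simp
  also have "\<dots> \<le> real q ^ (2 + M + 2 * r) * ?p"
    using c by (rule mult_right_mono) simp
  finally show ?thesis .
qed

text \<open>Clique points on one line lie in one block and have pairwise different colours, of which
  a block offers only \<open>s\<close>.\<close>

lemma clique_on_line:
  assumes "l \<in> L" "A \<subseteq> pts l" "\<And>u v. u \<in> A \<Longrightarrow> v \<in> A \<Longrightarrow> u \<noteq> v \<Longrightarrow> adjacent \<omega> u v"
  shows "card A \<le> s"
proof (cases "A = {}")
  case False
  then obtain a where a: "a \<in> A" by blast
  let ?f = "snd (\<omega> l)"
  have j: "joined s (\<omega> l) u v" if "u \<in> A" "v \<in> A" "u \<noteq> v" for u v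
    using assms that by (intro adjacent_joined) auto
  have "inj_on ?f A" using j by (auto simp: inj_on_def joined_def)
  moreover have "?f ` A \<subseteq> {?f a div s * s..<(?f a div s + 1) * s}"
  proof
    fix c assume "c \<in> ?f ` A"
    then obtain u where "u \<in> A" "c = ?f u" by blast
    then have "c div s = ?f a div s" using j[of u a] a by (cases "u = a") (auto simp: joined_def)
    then show "c \<in> {?f a div s * s..<(?f a div s + 1) * s}"
      using div_eq_iff_interval[of s c "?f a div s"] s_ge by auto
  qed
  ultimately have "card A \<le> card {?f a div s * s..<(?f a div s + 1) * s}"
    by (metis card_image card_mono finite_atLeastLessThan)
  then show ?thesis by simp
qed simp

lemma adjacent_same_block:
  assumes "adjacent \<omega> u v"
  shows "same_block s (\<omega> (line_of {u, v})) {u, v}"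
  using adjacent_joined[OF assms line_of[OF adjacent_collinear[OF assms]]]
  by (auto simp: joined_def same_block_def)

text \<open>A line with \<open>M + r * r\<close> clique points still has \<open>M\<close> base
  points after the loss of \<open>r * r\<close> in \<open>distinct_joining_lines\<close>. If no line
  is that rich, the same number is the cap in \<open>general_position\<close>, which explains the
  lower bound on \<open>s\<close>.\<close>

lemma large_clique_cases:
  assumes "U \<subseteq> V" "card U = s + r" "\<And>u v. u \<in> U \<Longrightarrow> v \<in> U \<Longrightarrow> u \<noteq> v \<Longrightarrow> adjacent \<omega> u v"
    and "s > k + k * k * (M + r * r)" "M > 1"
  shows "cone_clique M r \<omega> \<or> scattered_clique k \<omega>"
proof -
  have fU: "finite U" using assms finite_V finite_subset by blast
  show ?thesis
  proof (cases "\<exists>l\<in>L. card (U \<inter> pts l) \<ge> M + r * r")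
    case True
    then obtain l where l: "l \<in> L" "card (U \<inter> pts l) \<ge> M + r * r" by blast
    have "card (U \<inter> pts l) \<le> s" using assms(3) l by (intro clique_on_line) auto
    moreover have "card (U \<inter> pts l) + card (U - pts l) = card U"
      using fU by (metis card_Diff_subset_Int card_mono finite_Int inf_le1 le_add_diff_inverse)
    ultimately have "card (U - pts l) \<ge> r" using assms(2) by linarith
    then obtain X where X: "X \<subseteq> U - pts l" "card X = r" by (meson obtain_subset_with_card_n)
    have col: "collinear x y" if "x \<in> X" "y \<in> U \<inter> pts l" for x y
      using that X assms(3)[of x y] by (auto intro: adjacent_collinear)
    obtain B where B: "B \<subseteq> U \<inter> pts l" "card B = M" "inj_on (\<lambda>(x, y). line_of {x, y}) (X \<times> B)"
      using distinct_joining_lines[of l "U \<inter> pts l" X r M] l X assms(1) col by auto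
    have "(l, B, X) \<in> cones M r"
      using l B X assms(1) col unfolding cones_def by blast
    moreover have "same_block s (\<omega> (line_of {x, y})) {x, y}" if "x \<in> X" "y \<in> B" for x y
      using that X B by (intro adjacent_same_block assms(3)) auto
    moreover have "same_block s (\<omega> l) B"
    proof -
      have j: "joined s (\<omega> l) u v" if "u \<in> B" "v \<in> B" "u \<noteq> v" for u v
        using B l that assms(3)[of u v] by (intro adjacent_joined) auto
      \<comment> \<open>That \<open>l\<close> is selected is seen from one edge inside
        \<open>B\<close>, so two points are required; hence \<open>M > 1\<close>.\<close>
      have "\<exists>u\<in>B. \<exists>v\<in>B. u \<noteq> v"
        using B(2) assms(5) by (metis One_nat_def card_le_Suc0_iff_eq card.infinite not_less not_less_zero less_imp_le_nat)
      then show ?thesis using j unfolding same_block_def joined_def by metis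
    qed
    ultimately show ?thesis unfolding cone_clique_def by blast
  next
    case False
    then have "\<And>l. l \<in> L \<Longrightarrow> card (U \<inter> pts l) \<le> M + r * r" by force
    then obtain Z where Z: "Z \<subseteq> U" "card Z = k" "\<forall>l\<in>L. card (Z \<inter> pts l) \<le> 2"
      using general_position[of U "M + r * r" k] assms by auto
    have "Z \<in> scattered_sets k"
    proof -
      have "collinear u v" if "u \<in> Z" "v \<in> Z" "u \<noteq> v" for u v
        using that Z(1) by (intro adjacent_collinear[OF assms(3)]) auto
      then show ?thesis using Z assms(1) by (auto simp: scattered_sets_def)
    qed
    moreover have "same_block s (\<omega> (line_of e)) e" if e: "e \<subseteq> Z" "card e = 2" for e
    proof -
      obtain u v where uv: "e = {u, v}" "u \<noteq> v" using e(2) by (meson card_2_iff)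
      then have "adjacent \<omega> u v" using e Z by (intro assms(3)) auto
      then show ?thesis using uv adjacent_same_block by simp
    qed
    ultimately show ?thesis by (auto simp: scattered_clique_def)
  qed
qed

section \<open>Complete graphs inside every large vertex set\<close>

definition clique_poor :: "nat \<Rightarrow> ('l \<Rightarrow> nat \<times> ('v \<Rightarrow> nat)) \<Rightarrow> bool" where
  "clique_poor w \<omega> \<longleftrightarrow> (\<exists>W\<in>{W. W \<subseteq> V \<and> card W = w}. \<forall>l\<in>L. \<not> rainbow s (\<omega> l) (W \<inter> pts l))"

lemma not_clique_poor:
  assumes "\<not> clique_poor w \<omega>" "W \<subseteq> V" "card W \<ge> w"
  shows "\<exists>A\<subseteq>W. card A = s \<and> (\<forall>u\<in>A. \<forall>v\<in>A. u \<noteq> v \<longrightarrow> adjacent \<omega> u v)"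
proof -
  obtain W' where W': "W' \<subseteq> W" "card W' = w" using assms(3) by (meson obtain_subset_with_card_n)
  moreover have "W' \<subseteq> V" using W' assms(2) by blast
  ultimately obtain l where l: "l \<in> L" "rainbow s (\<omega> l) (W' \<inter> pts l)"
    using assms(1) unfolding clique_poor_def by blast
  then have "\<forall>j\<in>{..<s}. \<exists>v. v \<in> W' \<inter> pts l \<and> snd (\<omega> l) v = j" by (auto simp: rainbow_def)
  from bchoice[OF this] obtain g where
    g: "\<And>j. j < s \<Longrightarrow> g j \<in> W' \<inter> pts l" "\<And>j. j < s \<Longrightarrow> snd (\<omega> l) (g j) = j"
    by auto
  have "inj_on g {..<s}" using g(2) by (metis inj_onI lessThan_iff)
  then have "card (g ` {..<s}) = s" by (simp add: card_image)
  moreover have "adjacent \<omega> u v" if "u \<in> g ` {..<s}" "v \<in> g ` {..<s}" "u \<noteq> v" for u v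
    using that l g by (auto simp: adjacent_def joined_def rainbow_def intro!: bexI[of _ l])
  moreover have "g ` {..<s} \<subseteq> W" using g W' by auto
  ultimately show ?thesis by blast
qed

text \<open>At least \<open>q^2 / 8\<close> lines meet \<open>W\<close> in enough points for
  \<open>freq_not_rainbow\<close>, and each independently succeeds with frequency at least
  \<open>1 / (2 T)\<close>; the product of the two is the exponent
  \<open>q^2 / (16 T)\<close>.\<close>

lemma freq_clique_poor:
  "freq outcomes (clique_poor (2 * q * (K * (2 * s\<^sup>2))))
   \<le> real q ^ (2 * (2 * q * (K * (2 * s\<^sup>2)))) * exp (- (real q ^ 2 / (16 * real T)))"
proof -
  let ?k = "K * (2 * s\<^sup>2)" let ?w = "2 * q * ?k"
  let ?S = "{W. W \<subseteq> V \<and> card W = ?w}"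
  have k: "?k > 0" using K_pos s_ge by simp
  have "card ?S \<le> (q\<^sup>2) ^ ?w" by (rule card_subsets_le[OF finite_V card_V])
  then have "real (card ?S) \<le> real ((q\<^sup>2) ^ ?w)" by (rule of_nat_mono)
  then have c: "real (card ?S) \<le> real q ^ (2 * ?w)" by (simp add: power_mult)
  have fin: "finite ?S" using finite_V by auto
  have "freq outcomes (clique_poor ?w)
      \<le> (\<Sum>W\<in>?S. freq outcomes (\<lambda>\<omega>. \<forall>l\<in>L. \<not> rainbow s (\<omega> l) (W \<inter> pts l)))"
    unfolding clique_poor_def by (rule freq_Bex_le[OF fin])
  also have "\<dots> \<le> (\<Sum>W\<in>?S. exp (- (real q ^ 2 / (16 * real T))))"
  proof (rule sum_mono)
    fix W assume W: "W \<in> ?S"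
    let ?G = "{l \<in> L. ?k \<le> card (W \<inter> pts l)}"
    have G: "real q ^ 2 \<le> 8 * real (card ?G)" using many_rich_lines[of W ?k] W k by simp
    have "freq outcomes (\<lambda>\<omega>. \<forall>l\<in>L. \<not> rainbow s (\<omega> l) (W \<inter> pts l))
        \<le> freq outcomes (\<lambda>\<omega>. \<forall>l\<in>?G. \<not> rainbow s (\<omega> l) (W \<inter> pts l))"
      by (intro freq_mono finite_outcomes) auto
    also have "\<dots> = (\<Prod>l\<in>?G. freq Y (\<lambda>y. \<not> rainbow s y (W \<inter> pts l)))"
      by (rule freq_outcomes) auto
    also have "\<dots> \<le> (\<Prod>l\<in>?G. 1 - 1 / (2 * real T))"
      using W finite_V T_pos K_pos s_ge
      by (intro prod_mono conjI freq_nonneg freq_not_rainbow) auto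
    also have "\<dots> = (1 - 1 / (2 * real T)) ^ card ?G" by simp
    also have "\<dots> \<le> exp (- (1 / (2 * real T))) ^ card ?G"
    proof (rule power_mono)
      show "1 - 1 / (2 * real T) \<le> exp (- (1 / (2 * real T)))"
        using exp_ge_add_one_self[of "- (1 / (2 * real T))"] by simp
      show "0 \<le> 1 - 1 / (2 * real T)" using T_pos by (simp add: field_simps)
    qed
    also have "\<dots> = exp (- (real (card ?G) / (2 * real T)))"
      by (simp add: exp_of_nat_mult[symmetric])
    also have "\<dots> \<le> exp (- (real q ^ 2 / (16 * real T)))"
      using G T_pos by (simp add: field_simps)
    finally show "freq outcomes (\<lambda>\<omega>. \<forall>l\<in>L. \<not> rainbow s (\<omega> l) (W \<inter> pts l))
        \<le> exp (- (real q ^ 2 / (16 * real T)))" .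
  qed
  also have "\<dots> = real (card ?S) * exp (- (real q ^ 2 / (16 * real T)))" by simp
  also have "\<dots> \<le> real q ^ (2 * ?w) * exp (- (real q ^ 2 / (16 * real T)))"
    using c by (rule mult_right_mono) simp
  finally show ?thesis .
qed

end

section \<open>Affine planes\<close>

text \<open>The vertex \<open>v\<close> stands for the point \<open>(v div q, v mod q)\<close> of the affine plane over the field with
  \<open>q\<close> elements. Vertical lines are left out.\<close>

definition affine_line :: "nat \<Rightarrow> nat \<Rightarrow> nat \<times> nat \<Rightarrow> nat set" where
  "affine_line n q = (\<lambda>(a, b). {v. v < n \<and> v mod q = (a * (v div q) + b) mod q})"

lemma affine_line_iff_cong:
  "v \<in> affine_line n q (a, b) \<longleftrightarrow> v < n \<and> [int a * int (v div q) + int b = int (v mod q)] (mod int q)"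
proof -
  have "[int a * int (v div q) + int b = int (v mod q)] (mod int q)
      \<longleftrightarrow> [a * (v div q) + b = v mod q] (mod q)"
    by (metis cong_int_iff of_nat_add of_nat_mult)
  then show ?thesis
    by (auto simp: affine_line_def unique_euclidean_semiring_class.cong_def)
qed

lemma unique_intercept:
  fixes q a x y :: nat
  assumes "q > 0"
  shows "\<exists>!b. b < q \<and> [int a * int x + int b = int y] (mod int q)"
proof
  define b where "b = nat ((int y - int a * int x) mod int q)"
  have ib: "int b = (int y - int a * int x) mod int q" using assms by (simp add: b_def)
  have "b < q" using ib assms by (metis of_nat_less_iff of_nat_0_less_iff pos_mod_bound)
  moreover have "[int a * int x + int b = int y] (mod int q)"
    unfolding ib unique_euclidean_semiring_class.cong_def by (simp add: mod_simps)
  ultimately show "b < q \<and> [int a * int x + int b = int y] (mod int q)" by blast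
  fix b' assume b': "b' < q \<and> [int a * int x + int b' = int y] (mod int q)"
  have "[int a * int x + int b' = int a * int x + int b] (mod int q)"
    using b' \<open>[int a * int x + int b = int y] (mod int q)\<close> cong_sym cong_trans by blast
  then have "[int b' = int b] (mod int q)" by (simp only: cong_add_lcancel)
  then show "b' = b" using b' \<open>b < q\<close> by (simp add: cong_int_iff unique_euclidean_semiring_class.cong_def)
qed

lemma cong_nat_eq:
  fixes a b q :: nat
  assumes "[int a = int b] (mod int q)" "a < q" "b < q"
  shows "a = b"
  using assms by (simp add: cong_int_iff unique_euclidean_semiring_class.cong_def)

lemma line_system_affine:
  assumes "prime q" "n \<le> q\<^sup>2"
  shows "line_system {..<n} ({..<q} \<times> {..<q}) (affine_line n q) q"
proof
  have q: "q > 0" using assms(1) by (rule prime_gt_0_nat)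
  have div_less: "v div q < q" if "v < n" for v
    using that assms(2) by (intro less_mult_imp_div_less) (simp add: power2_eq_square)
  show "finite {..<n}" "finite ({..<q} \<times> {..<q})" "q > 0" using q by auto
  show "card {..<n} \<le> q\<^sup>2" using assms(2) by simp
  show "card ({..<q} \<times> {..<q}) = q\<^sup>2" by (simp add: card_cartesian_product power2_eq_square)
  show "affine_line n q l \<subseteq> {..<n}" for l by (auto simp: affine_line_def split: prod.split)
  show "card (affine_line n q l) \<le> q" if "l \<in> {..<q} \<times> {..<q}" for l
  proof -
    obtain a b where l: "l = (a, b)" by (cases l)
    \<comment> \<open>On a line that is not vertical the column \<open>v div q\<close> determines
      \<open>v mod q\<close>, and both together determine \<open>v\<close>.\<close>
    have "inj_on (\<lambda>v. v div q) (affine_line n q l)"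
      unfolding l affine_line_def
      by (rule inj_onI) (metis (mono_tags, lifting) case_prod_conv mem_Collect_eq div_mult_mod_eq)
    moreover have "(\<lambda>v. v div q) ` affine_line n q l \<subseteq> {..<q}"
      using div_less by (auto simp: l affine_line_def)
    ultimately have "card (affine_line n q l) \<le> card {..<q}"
      by (intro card_inj_on_le) auto
    then show ?thesis by simp
  qed
  show "card {l \<in> {..<q} \<times> {..<q}. v \<in> affine_line n q l} = q" if v: "v \<in> {..<n}" for v
  proof -
    have "\<forall>a. \<exists>b. b < q \<and> [int a * int (v div q) + int b = int (v mod q)] (mod int q)"
      using unique_intercept[OF q] by blast
    then obtain f where f: "\<And>a. f a < q" "\<And>a. [int a * int (v div q) + int (f a) = int (v mod q)] (mod int q)"
      by metis
    have "{l \<in> {..<q} \<times> {..<q}. v \<in> affine_line n q l} = (\<lambda>a. (a, f a)) ` {..<q}"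
    proof -
      have "b = f a" if "b < q" "v \<in> affine_line n q (a, b)" for a b
        using that f unique_intercept[OF q, of a "v div q" "v mod q"] unfolding affine_line_iff_cong by blast
      moreover have "v \<in> affine_line n q (a, f a)" for a
        using f v by (simp add: affine_line_iff_cong)
      ultimately show ?thesis using f by auto
    qed
    moreover have "inj_on (\<lambda>a. (a, f a)) {..<q}" by (auto simp: inj_on_def)
    ultimately show ?thesis by (simp add: card_image)
  qed
  show "l = m" if lm: "l \<in> {..<q} \<times> {..<q}" "m \<in> {..<q} \<times> {..<q}" "u \<noteq> v"
    "{u, v} \<subseteq> affine_line n q l" "{u, v} \<subseteq> affine_line n q m" for l m u v
  proof -
    obtain a b where l: "l = (a, b)" by (cases l)
    obtain c d where m: "m = (c, d)" by (cases m)
    let ?x = "int (u div q)" and ?x' = "int (v div q)"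
    have 1: "[int a * ?x + int b = int (u mod q)] (mod int q)" "[int a * ?x' + int b = int (v mod q)] (mod int q)"
      "[int c * ?x + int d = int (u mod q)] (mod int q)" "[int c * ?x' + int d = int (v mod q)] (mod int q)"
      and n: "u < n" "v < n"
      using lm(4,5) by (auto simp: l m affine_line_iff_cong)
    \<comment> \<open>Differences remove both intercepts and leave a product of a slope difference
      and a column difference, so that primality of \<open>q\<close> applies.\<close>
    have "int q dvd ((int a * ?x + int b) - (int c * ?x + int d)) - ((int a * ?x' + int b) - (int c * ?x' + int d))"
      using cong_trans[OF 1(1) cong_sym[OF 1(3)]] cong_trans[OF 1(2) cong_sym[OF 1(4)]]
      unfolding cong_iff_dvd_diff by (rule dvd_diff)
    then have "int q dvd (int a - int c) * (?x - ?x')" by (simp add: algebra_simps)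
    then have "int q dvd int a - int c \<or> int q dvd ?x - ?x'"
      using assms(1) by (simp add: prime_dvd_mult_iff)
    moreover have "\<not> int q dvd ?x - ?x'"
    proof
      assume "int q dvd ?x - ?x'"
      then have "u div q = v div q"
        using div_less n by (intro cong_nat_eq[of _ _ q]) (auto simp: cong_iff_dvd_diff)
      moreover from this have "u mod q = v mod q"
        using lm(4) by (auto simp: l affine_line_def)
      ultimately show False using lm(3) by (metis div_mult_mod_eq)
    qed
    ultimately have ac: "a = c"
      using lm(1,2) l m by (intro cong_nat_eq[of _ _ q]) (auto simp: cong_iff_dvd_diff)
    then have "b = d"
      using 1 lm(1,2) l m unique_intercept[OF q, of a "u div q" "u mod q"] by auto
    then show "l = m" using ac l m by simp
  qed
qed

text \<open>The difference of two distinct columns is invertible modulo \<open>q\<close>, so the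
  slope exists as a quotient, and the intercept follows from one of the points.\<close>

lemma affine_collinear:
  assumes "prime q" "n \<le> q\<^sup>2" "u < n" "v < n" "u div q \<noteq> v div q"
  shows "line_system.collinear ({..<q} \<times> {..<q}) (affine_line n q) u v"
proof -
  interpret line_system "{..<n}" "{..<q} \<times> {..<q}" "affine_line n q" q
    by (rule line_system_affine[OF assms(1,2)])
  have div_less: "v div q < q" if "v < n" for v
    using that assms(2) by (intro less_mult_imp_div_less) (simp add: power2_eq_square)
  let ?x = "int (u div q)" and ?x' = "int (v div q)"
  have "\<not> int q dvd ?x - ?x'"
  proof
    assume "int q dvd ?x - ?x'"
    then have "u div q = v div q"
      using div_less assms(3,4) by (intro cong_nat_eq[of _ _ q]) (auto simp: cong_iff_dvd_diff)
    then show False using assms(5) by simp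
  qed
  then have "coprime (?x - ?x') (int q)"
    using assms(1) by (metis coprime_commute prime_imp_coprime prime_nat_int_transfer)
  then obtain i where i: "[(?x - ?x') * i = 1] (mod int q)" using cong_solve_coprime_int by blast
  define a where "a = nat ((i * (int (u mod q) - int (v mod q))) mod int q)"
  have ia: "int a = (i * (int (u mod q) - int (v mod q))) mod int q" using q_pos by (simp add: a_def)
  have a: "a < q" using ia q_pos by (metis of_nat_less_iff of_nat_0_less_iff pos_mod_bound)
  have "[int a * (?x - ?x') = i * (int (u mod q) - int (v mod q)) * (?x - ?x')] (mod int q)"
    unfolding ia unique_euclidean_semiring_class.cong_def by (simp add: mod_simps)
  also have "i * (int (u mod q) - int (v mod q)) * (?x - ?x') = ((?x - ?x') * i) * (int (u mod q) - int (v mod q))"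
    by (simp only: mult_ac)
  also have "[\<dots> = 1 * (int (u mod q) - int (v mod q))] (mod int q)"
    using i by (rule cong_scalar_right)
  finally have slope: "[int a * (?x - ?x') = int (u mod q) - int (v mod q)] (mod int q)" by simp
  obtain b where b: "b < q" "[int a * ?x + int b = int (u mod q)] (mod int q)"
    using unique_intercept[OF q_pos] by blast
  have "[(int a * ?x + int b) - int a * (?x - ?x') = int (u mod q) - (int (u mod q) - int (v mod q))] (mod int q)"
    using b(2) slope by (rule cong_diff)
  then have "[int a * ?x' + int b = int (v mod q)] (mod int q)" by (simp add: algebra_simps)
  then show ?thesis
    using a b assms unfolding collinear_def by (intro bexI[of _ "(a, b)"]) (auto simp: affine_line_iff_cong)
qed

text \<open>For a given point only its own column is lost, at most \<open>q\<close> points including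
  itself; \<open>n \<ge> 2 * q\<close> keeps this within half of all points.\<close>

lemma card_affine_collinear:
  assumes "prime q" "n \<le> q\<^sup>2" "n \<ge> 2 * q"
  shows "real n ^ 2 / 2 \<le> real (card {(u, v) \<in> {..<n} \<times> {..<n}.
     line_system.collinear ({..<q} \<times> {..<q}) (affine_line n q) u v \<and> u \<noteq> v})"
    (is "_ \<le> real (card ?D)")
proof -
  have q: "q > 0" using assms(1) by (rule prime_gt_0_nat)
  let ?E = "Sigma {..<n} (\<lambda>u. {v \<in> {..<n}. v div q \<noteq> u div q})"
  have "?E \<subseteq> ?D" using affine_collinear[OF assms(1,2)] by auto
  then have "card ?E \<le> card ?D"
    by (intro card_mono) (auto intro: finite_subset[of _ "{..<n} \<times> {..<n}"])
  moreover have "card ?E = (\<Sum>u<n. card {v \<in> {..<n}. v div q \<noteq> u div q})"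
    by (intro card_SigmaI) auto
  moreover have "(\<Sum>u<n. n - q) \<le> (\<Sum>u<n. card {v \<in> {..<n}. v div q \<noteq> u div q})"
  proof (rule sum_mono)
    fix u
    have "{..<n} - {u div q * q..<(u div q + 1) * q} \<subseteq> {v \<in> {..<n}. v div q \<noteq> u div q}"
      using q by (auto simp: div_eq_iff_interval)
    then have "card ({..<n} - {u div q * q..<(u div q + 1) * q}) \<le> card {v \<in> {..<n}. v div q \<noteq> u div q}"
      by (intro card_mono) auto
    moreover have "card {..<n} - card {u div q * q..<(u div q + 1) * q} \<le> card ({..<n} - {u div q * q..<(u div q + 1) * q})"
      by (rule diff_card_le_card_Diff) simp
    ultimately show "n - q \<le> card {v \<in> {..<n}. v div q \<noteq> u div q}" by simp
  qed
  ultimately have "n * (n - q) \<le> card ?D" by simp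
  then have "real (n * (n - q)) \<le> real (card ?D)" by (rule of_nat_mono)
  moreover have "real n * (real n / 2) \<le> real n * real (n - q)"
    using assms(3) by (intro mult_left_mono) (auto simp: of_nat_diff)
  ultimately show ?thesis by (simp add: power2_eq_square)
qed

section \<open>Primes in short multiplicative intervals\<close>

definition primorial :: "nat \<Rightarrow> nat" where
  "primorial n = \<Prod>{p. prime p \<and> p \<le> n}"

text \<open>The middle coefficient occurs twice in a row whose sum is
  \<open>2 * 4 ^ m\<close>.\<close>

lemma choose_odd_middle_le: "(2 * m + 1) choose m \<le> 4 ^ m"
proof -
  have "((2 * m + 1) choose m) + ((2 * m + 1) choose (m + 1)) = (\<Sum>k\<in>{m, m + 1}. (2 * m + 1) choose k)"
    by simp
  also have "\<dots> \<le> (\<Sum>k\<le>2 * m + 1. (2 * m + 1) choose k)" by (rule sum_mono2) auto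
  also have "\<dots> = 2 ^ (2 * m + 1)" by (rule choose_row_sum)
  also have "\<dots> = 2 * 4 ^ m" by (simp add: power_mult)
  finally show ?thesis
    using binomial_symmetric[of m "2 * m + 1"] by simp
qed

lemma prod_coprime_dvd:
  assumes "finite A" "\<And>a. a \<in> A \<Longrightarrow> a dvd (x::nat)"
    and "\<And>a b. a \<in> A \<Longrightarrow> b \<in> A \<Longrightarrow> a \<noteq> b \<Longrightarrow> coprime a b"
  shows "\<Prod>A dvd x"
  using assms
proof (induction A rule: finite_induct)
  case (insert a A)
  have "coprime a (\<Prod>A)" using insert by (intro prod_coprime_right) auto
  then show ?case using insert by (simp add: divides_mult)
qed simp

text \<open>A prime above \<open>m + 1\<close> and up to \<open>2 * m + 1\<close> divides the
  factorial of \<open>2 * m + 1\<close> but not those of \<open>m\<close> and \<open>m + 1\<close>,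
  so it divides the binomial coefficient.\<close>

lemma primorial_odd_le: "primorial (2 * m + 1) \<le> primorial (m + 1) * ((2 * m + 1) choose m)"
proof -
  let ?A = "{p. prime p \<and> p \<le> m + 1}" and ?B = "{p. prime p \<and> m + 1 < p \<and> p \<le> 2 * m + 1}"
  have "{p. prime p \<and> p \<le> 2 * m + 1} = ?A \<union> ?B" by auto
  then have eq: "primorial (2 * m + 1) = primorial (m + 1) * \<Prod>?B"
    unfolding primorial_def by (simp add: prod.union_disjoint disjoint_iff)
  have "\<Prod>?B dvd (2 * m + 1) choose m"
  proof (rule prod_coprime_dvd)
    show "finite ?B" by simp
  next
    fix p assume p: "p \<in> ?B"
    then have "prime p" by simp
    have "p dvd fact (2 * m + 1)" using p \<open>prime p\<close> by (simp add: prime_dvd_fact_iff del: fact_Suc)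
    also have "(fact (2 * m + 1) :: nat) = fact m * fact (m + 1) * ((2 * m + 1) choose m)"
      using binomial_fact_lemma[of m "2 * m + 1"] by (simp del: fact_Suc)
    finally have "p dvd fact m \<or> p dvd fact (m + 1) \<or> p dvd (2 * m + 1) choose m"
      using \<open>prime p\<close> by (simp add: prime_dvd_mult_iff del: fact_Suc)
    then show "p dvd (2 * m + 1) choose m"
      using p \<open>prime p\<close> by (auto simp: prime_dvd_fact_iff simp del: fact_Suc)
  next
    fix p p' assume "p \<in> ?B" "p' \<in> ?B" "p \<noteq> p'"
    then show "coprime p p'" by (simp add: primes_coprime)
  qed
  then have "\<Prod>?B \<le> (2 * m + 1) choose m" by (rule dvd_imp_le) simp
  then show ?thesis unfolding eq by simp
qed

text \<open>An even \<open>n > 2\<close> is not prime and adds no factor; for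
  \<open>n = 2 * m + 1\<close> the step down to \<open>m + 1\<close> costs \<open>4 ^ m\<close>, and
  the exponents add up to \<open>n\<close>.\<close>

lemma primorial_le: "primorial n \<le> 4 ^ n"
proof (induction n rule: less_induct)
  case (less n)
  have "n \<le> 2 \<or> (n > 2 \<and> even n) \<or> (\<exists>m. n = 2 * m + 1 \<and> m > 0)"
  proof (cases "even n")
    case False
    then obtain m where m: "n = 2 * m + 1" by (rule oddE)
    show ?thesis
    proof (cases "m = 0")
      case False
      then have "\<exists>m. n = 2 * m + 1 \<and> m > 0" using m by blast
      then show ?thesis by blast
    qed (simp add: m)
  qed auto
  then consider "n \<le> 2" | "n > 2" "even n" | m where "n = 2 * m + 1" "m > 0" by blast
  then show ?case
  proof cases
    case 1
    have "p = 2" if "prime p" "p \<le> n" for p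
      using that 1 prime_ge_2_nat[of p] by simp
    then consider "{p. prime p \<and> p \<le> n} = {}" | "{p. prime p \<and> p \<le> n} = {2}" by blast
    then show ?thesis
    proof cases
      case 1
      then show ?thesis unfolding primorial_def 1 by simp
    next
      case 2
      have "2 \<in> {p. prime p \<and> p \<le> n}" unfolding 2 by simp
      then have "(4::nat) ^ 1 \<le> 4 ^ n" by (intro power_increasing) auto
      then show ?thesis unfolding primorial_def 2 by simp
    qed
  next
    case 2
    have "\<not> prime n" using 2 primes_dvd_imp_eq[of 2 n] by auto
    have "p \<le> n - 1" if "prime p" "p \<le> n" for p
    proof -
      have "p \<noteq> n" using that \<open>\<not> prime n\<close> by blast
      then show ?thesis using that by simp
    qed
    then have "{p. prime p \<and> p \<le> n} = {p. prime p \<and> p \<le> n - 1}" by force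
    then have "primorial n = primorial (n - 1)" by (simp add: primorial_def)
    also have "\<dots> \<le> 4 ^ (n - 1)" using 2 by (intro less) simp
    also have "\<dots> \<le> 4 ^ n" by (rule power_increasing) auto
    finally show ?thesis .
  next
    case 3
    have "primorial n \<le> primorial (m + 1) * ((2 * m + 1) choose m)"
      using primorial_odd_le 3 by simp
    also have "\<dots> \<le> 4 ^ (m + 1) * 4 ^ m"
      using 3 by (intro mult_mono less choose_odd_middle_le) auto
    also have "\<dots> = 4 ^ n" using 3 by (simp add: power_add[symmetric] mult_2)
    finally show ?thesis .
  qed
qed

section \<open>Prime powers in central binomial coefficients\<close>

lemma multiplicity_eq_card:
  assumes "prime (p::nat)" "m > 0" "m \<le> N"
  shows "multiplicity p m = card {i \<in> {1..N}. p ^ i dvd m}"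
proof -
  have "multiplicity p m < N + 1"
  proof (rule multiplicity_lessI)
    have "N + 1 < p ^ (N + 1)" using assms(1) by (meson less_exp less_le_trans power_mono prime_ge_2_nat zero_le)
    then show "\<not> p ^ (N + 1) dvd m" using assms by (auto dest: dvd_imp_le)
  qed (use assms in auto)
  then have "{i \<in> {1..N}. p ^ i dvd m} = {1..multiplicity p m}"
    using assms by (subst power_dvd_iff_le_multiplicity) (auto simp: not_prime_unit)
  then show ?thesis by simp
qed

text \<open>Legendre's formula with a free cut-off: terms beyond \<open>n\<close> vanish, and a
  common \<open>N\<close> allows the formulas for \<open>n\<close> and \<open>2 * n\<close> to be
  subtracted termwise.\<close>

lemma legendre:
  assumes "prime (p::nat)" "n \<le> N"
  shows "multiplicity p (fact n) = (\<Sum>i=1..N. n div p ^ i)"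
  using assms(2)
proof (induction n)
  case (Suc n)
  have "multiplicity p (fact (Suc n)) = multiplicity p (Suc n) + multiplicity p (fact n)"
    using assms(1) by (simp add: prime_elem_multiplicity_mult_distrib del: mult_Suc)
  also have "\<dots> = (\<Sum>i=1..N. of_bool (p ^ i dvd Suc n)) + (\<Sum>i=1..N. n div p ^ i)"
    using Suc assms(1) multiplicity_eq_card[of p "Suc n" N]
    by (simp add: of_bool_def sum.If_cases Int_def)
  also have "\<dots> = (\<Sum>i=1..N. Suc n div p ^ i)"
    unfolding sum.distrib[symmetric]
    by (intro sum.cong refl) (auto simp: div_Suc dvd_eq_mod_eq_0 of_bool_def)
  finally show ?case .
qed simp

text \<open>By Legendre's formula each power \<open>p ^ i\<close> contributes at most 1 to the
  multiplicity, and nothing once it exceeds \<open>2 * n\<close>.\<close>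

lemma prime_power_central_binomial_le:
  assumes "prime (p::nat)" "n > 0"
  shows "p ^ multiplicity p ((2 * n) choose n) \<le> 2 * n"
proof -
  let ?N = "2 * n" let ?v = "multiplicity p (?N choose n)"
  have "(fact ?N :: nat) = fact n * fact n * (?N choose n)"
    using binomial_fact_lemma[of n ?N] by simp
  then have "multiplicity p (fact ?N :: nat) = 2 * multiplicity p (fact n :: nat) + ?v"
    using assms(1) by (simp add: prime_elem_multiplicity_mult_distrib)
  then have eq: "(\<Sum>i=1..?N. ?N div p ^ i) = 2 * (\<Sum>i=1..?N. n div p ^ i) + ?v"
    using assms(1) by (simp add: legendre[where N = ?N])
  have "(\<Sum>i=1..?N. ?N div p ^ i) \<le> (\<Sum>i=1..?N. 2 * (n div p ^ i) + of_bool (p ^ i \<le> ?N))"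
  proof (rule sum_mono)
    fix i
    have p0: "p ^ i > 0" using assms(1) by (simp add: prime_gt_0_nat)
    show "?N div p ^ i \<le> 2 * (n div p ^ i) + of_bool (p ^ i \<le> ?N)"
    proof (cases "p ^ i \<le> ?N")
      case True
      have "n < (n div p ^ i + 1) * p ^ i"
        using p0 by (metis Suc_eq_plus1 dividend_less_div_times add.commute mult_Suc)
      then have "?N < (2 * (n div p ^ i) + 2) * p ^ i" by (simp add: algebra_simps)
      then have "?N div p ^ i < 2 * (n div p ^ i) + 2" by (rule less_mult_imp_div_less)
      then show ?thesis using True by simp
    qed simp
  qed
  then have "?v \<le> (\<Sum>i=1..?N. of_bool (p ^ i \<le> ?N))"
    using eq by (simp add: sum.distrib sum_distrib_left)
  also have "\<dots> = card {i \<in> {1..?N}. p ^ i \<le> ?N}"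
    by (simp add: of_bool_def sum.If_cases Int_def)
  finally have v: "?v \<le> card {i \<in> {1..?N}. p ^ i \<le> ?N}" .
  show ?thesis
  proof (rule ccontr)
    assume "\<not> ?thesis"
    then have gt: "p ^ ?v > ?N" by simp
    have "{i \<in> {1..?N}. p ^ i \<le> ?N} \<subseteq> {1..<?v}"
    proof
      fix i assume i: "i \<in> {i \<in> {1..?N}. p ^ i \<le> ?N}"
      then have "p ^ i < p ^ ?v" using gt by simp
      then have "i < ?v" by (rule power_less_imp_less_exp[OF prime_gt_1_nat[OF assms(1)]])
      then show "i \<in> {1..<?v}" using i by simp
    qed
    then have "card {i \<in> {1..?N}. p ^ i \<le> ?N} \<le> ?v - 1"
      using card_mono[of "{1..<?v}"] by simp
    moreover have "?v \<noteq> 0" using gt assms(2) by (intro notI) simp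
    ultimately show False using v by simp
  qed
qed

text \<open>Primes up to the square root of \<open>2 * n\<close> contribute at most
  \<open>2 * n\<close> each. Larger ones occur at most once and, by the gap, are at most
  \<open>m\<close>, so the primorial bound covers them.\<close>

lemma central_binomial_le_if_prime_gap:
  assumes "n > 0" "m \<le> 2 * n" "\<And>p. prime p \<Longrightarrow> p \<le> 2 * n \<Longrightarrow> p \<le> m"
  shows "(2 * n) choose n \<le> 4 ^ m * (2 * n) ^ (floor_sqrt (2 * n))"
proof -
  let ?N = "2 * n" let ?C = "?N choose n" let ?P = "{p. prime p \<and> p \<le> m}"
  have C: "?C > 0" by simp
  have sub: "prime_factors ?C \<subseteq> ?P"
  proof
    fix p assume "p \<in> prime_factors ?C"
    then have p: "prime p" "p dvd ?C" by auto
    have "?C dvd fact ?N" using binomial_fact_lemma[of n ?N] by (metis dvd_triv_right le_add2 mult_2)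
    then have "p \<le> ?N" using p by (meson dvd_trans prime_dvd_fact_iff)
    then show "p \<in> ?P" using assms(3) p by simp
  qed
  have "?C = (\<Prod>p\<in>prime_factors ?C. p ^ multiplicity p ?C)"
    using C by (simp add: prime_factorization_nat)
  \<comment> \<open>Giving the small primes a surplus factor \<open>p\<close> makes the product
    split into a primorial and a power of \<open>2 * n\<close>.\<close>
  also have "\<dots> \<le> (\<Prod>p\<in>prime_factors ?C. p * (if p \<le> floor_sqrt ?N then ?N else 1))"
  proof (intro prod_mono conjI)
    fix p assume "p \<in> prime_factors ?C"
    then have p: "prime p" by auto
    have le: "p ^ multiplicity p ?C \<le> ?N" using prime_power_central_binomial_le[OF p assms(1)] .
    show "p ^ multiplicity p ?C \<le> p * (if p \<le> floor_sqrt ?N then ?N else 1)"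
    proof (cases "p \<le> floor_sqrt ?N")
      case True
      have "1 * ?N \<le> p * ?N" using p by (intro mult_right_mono) (use prime_gt_0_nat[OF p] in auto)
      then show ?thesis using True le by (simp only: if_True)
    next
      case False
      then have "?N < p ^ 2" by (simp add: le_floor_sqrt_iff)
      then have "p ^ multiplicity p ?C < p ^ 2" using le by simp
      then have "multiplicity p ?C < 2" by (rule power_less_imp_less_exp[OF prime_gt_1_nat[OF p]])
      then have "multiplicity p ?C \<le> 1" by simp
      then have "p ^ multiplicity p ?C \<le> p ^ 1"
        using p by (intro power_increasing) (use prime_gt_0_nat[OF p] in auto)
      then show ?thesis using False by simp
    qed
  qed simp
  also have "\<dots> \<le> (\<Prod>p\<in>?P. p * (if p \<le> floor_sqrt ?N then ?N else 1))"
  proof -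
    let ?f = "\<lambda>p. p * (if p \<le> floor_sqrt ?N then ?N else 1)"
    have "0 < prod ?f (?P - prime_factors ?C)"
      using assms(1) by (intro prod_pos) (auto simp: prime_gt_0_nat)
    then have "1 * prod ?f (prime_factors ?C) \<le> prod ?f (?P - prime_factors ?C) * prod ?f (prime_factors ?C)"
      by (intro mult_right_mono) (simp_all only: One_nat_def Suc_le_eq zero_le)
    also have "\<dots> = prod ?f ?P" using sub by (intro prod.subset_diff[symmetric]) auto
    finally show ?thesis by simp
  qed
  also have "\<dots> = primorial m * ?N ^ card {p \<in> ?P. p \<le> floor_sqrt ?N}"
    unfolding prod.distrib primorial_def by (simp add: prod.If_cases Int_def)
  also have "\<dots> \<le> 4 ^ m * ?N ^ floor_sqrt ?N"
  proof (intro mult_mono primorial_le power_increasing)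
    have "{p \<in> ?P. p \<le> floor_sqrt ?N} \<subseteq> {1..floor_sqrt ?N}" by (auto simp: Suc_le_eq prime_gt_0_nat)
    then have "card {p \<in> ?P. p \<le> floor_sqrt ?N} \<le> card {1..floor_sqrt ?N}" by (intro card_mono) auto
    then show "card {p \<in> ?P. p \<le> floor_sqrt ?N} \<le> floor_sqrt ?N" by simp
  qed (use assms in auto)
  finally show ?thesis .
qed

section \<open>A weak form of Bertrand's postulate\<close>

lemma power4_le_central_binomial: "4 ^ n \<le> (2 * n + 1) * ((2 * n) choose n)"
proof -
  have "(4::nat) ^ n = (\<Sum>k\<le>2 * n. (2 * n) choose k)" by (simp add: choose_row_sum power_mult)
  also have "\<dots> \<le> (\<Sum>k\<le>2 * n. (2 * n) choose n)"
    using binomial_maximum[of "2 * n"] by (intro sum_mono) simp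
  finally show ?thesis by simp
qed

text \<open>With no prime in the interval the central binomial coefficient of
  \<open>2 * m + 1\<close>, about \<open>4 ^ (2 * m + 1)\<close>, would be bounded by
  \<open>4 ^ m\<close> times a subexponential factor. Accepting a ratio near 4 leaves the whole
  factor \<open>4 ^ (m + 1)\<close> for the contradiction and costs only constants later.\<close>

lemma eventually_prime_between:
  "\<forall>\<^sub>F m in sequentially. \<exists>p. prime p \<and> m < p \<and> p \<le> 4 * m + 2"
proof -
  have "\<forall>\<^sub>F m :: nat in sequentially. ln (4 * real m + 3) + sqrt (4 * real m + 2) * ln (4 * real m + 2) < (real m + 1) * ln 4"
    by real_asymp
  then show ?thesis
  proof eventually_elim
    case (elim m)
    show ?case
    proof (rule ccontr)
      assume *: "\<nexists>p. prime p \<and> m < p \<and> p \<le> 4 * m + 2"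
      define n where "n = 2 * m + 1"
      have n: "n > 0" "2 * n = 4 * m + 2" by (auto simp: n_def)
      have gap: "p \<le> m" if "prime p" "p \<le> 2 * n" for p
        using * that n(2) not_less by metis
      have "4 ^ m * 4 ^ (m + 1) = (4::nat) ^ n" by (simp add: n_def power_add mult_2)
      also have "\<dots> \<le> (2 * n + 1) * ((2 * n) choose n)" by (rule power4_le_central_binomial)
      also have "\<dots> \<le> (2 * n + 1) * (4 ^ m * (2 * n) ^ floor_sqrt (2 * n))"
        using n by (intro mult_left_mono central_binomial_le_if_prime_gap gap) auto
      also have "\<dots> = 4 ^ m * ((4 * m + 3) * (4 * m + 2) ^ floor_sqrt (4 * m + 2))"
      proof -
        have "2 * n + 1 = 4 * m + 3" using n(2) by simp
        then show ?thesis unfolding n(2) by (simp only: mult.left_commute)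
      qed
      finally have "4 ^ (m + 1) \<le> (4 * m + 3) * (4 * m + 2) ^ floor_sqrt (4 * m + 2)"
        by (subst (asm) mult_le_cancel1) simp
      then have "real (4 ^ (m + 1)) \<le> real ((4 * m + 3) * (4 * m + 2) ^ floor_sqrt (4 * m + 2))"
        by (rule of_nat_mono)
      then have "ln (real (4 ^ (m + 1))) \<le> ln (real ((4 * m + 3) * (4 * m + 2) ^ floor_sqrt (4 * m + 2)))"
        by (subst ln_le_cancel_iff) auto
      also have "\<dots> = ln (4 * real m + 3) + real (floor_sqrt (4 * m + 2)) * ln (4 * real m + 2)"
        by (simp add: ln_mult ln_realpow add.commute)
      also have "real (floor_sqrt (4 * m + 2)) * ln (4 * real m + 2) \<le> sqrt (4 * real m + 2) * ln (4 * real m + 2)"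
      proof (rule mult_right_mono)
        have "(floor_sqrt (4 * m + 2))\<^sup>2 \<le> 4 * m + 2" by simp
        then have "real ((floor_sqrt (4 * m + 2))\<^sup>2) \<le> real (4 * m + 2)" by (rule of_nat_mono)
        then show "real (floor_sqrt (4 * m + 2)) \<le> sqrt (4 * real m + 2)"
          by (intro real_le_rsqrt) simp
      qed simp
      finally have "ln (real (4 ^ (m + 1))) \<le> ln (4 * real m + 3) + sqrt (4 * real m + 2) * ln (4 * real m + 2)"
        by simp
      moreover have "ln (real (4 ^ (m + 1))) = (real m + 1) * ln 4"
        using ln_realpow[of 4 "m + 1"] by (simp only: of_nat_power of_nat_numeral of_nat_add of_nat_1)
      ultimately show False using elim by linarith
    qed
  qed
qed

lemma eventually_prime_sqrt:
  "\<forall>\<^sub>F n in sequentially. \<exists>q. prime q \<and> n \<le> q\<^sup>2 \<and> q\<^sup>2 \<le> 25 * n"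
proof -
  have "filterlim floor_sqrt at_top sequentially"
    unfolding filterlim_at_top
  proof
    fix Z :: nat
    show "\<forall>\<^sub>F n in sequentially. Z \<le> floor_sqrt n"
      using eventually_ge_at_top[of "Z\<^sup>2"] by eventually_elim (simp add: le_floor_sqrt_iff)
  qed
  from eventually_compose_filterlim[OF eventually_prime_between this]
  show ?thesis using eventually_ge_at_top[of 4]
  proof eventually_elim
    case (elim n)
    let ?m = "floor_sqrt n"
    obtain p where p: "prime p" "?m < p" "p \<le> 4 * ?m + 2" using elim by blast
    have "n < (Suc ?m)\<^sup>2" using Suc_floor_sqrt_power2_gt by blast
    also have "\<dots> \<le> p\<^sup>2" using p by (intro power_mono) auto
    finally have 1: "n \<le> p\<^sup>2" by simp
    have "2 \<le> ?m" using elim by (simp add: le_floor_sqrt_iff)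
    \<comment> \<open>From \<open>2 \<le> ?m\<close> the bound \<open>4 * ?m + 2\<close> is at most
      \<open>5 * ?m\<close>; its square is the origin of the constant 25.\<close>
    then have "p \<le> 5 * ?m" using p by simp
    then have "p\<^sup>2 \<le> (5 * ?m)\<^sup>2" by (rule power_mono) simp
    also have "\<dots> = 25 * ?m\<^sup>2" by (simp add: power_mult_distrib)
    also have "\<dots> \<le> 25 * n" by simp
    finally show ?case using 1 p by blast
  qed
qed

section \<open>From random labels to graphs\<close>

definition graph_of :: "'a set \<Rightarrow> ('a \<Rightarrow> 'a \<Rightarrow> bool) \<Rightarrow> 'a ugraph" where
  "graph_of V adj = \<lparr>verts = V, edges = {{u, v} | u v. u \<in> V \<and> v \<in> V \<and> adj u v}\<rparr>"

lemma contains_complete_graph_iff: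
  assumes "finite (verts G)"
  shows "contains_copy G (complete_graph m) \<longleftrightarrow>
    (\<exists>A\<subseteq>verts G. card A = m \<and> (\<forall>u\<in>A. \<forall>v\<in>A. u \<noteq> v \<longrightarrow> {u, v} \<in> edges G))"
proof
  assume "contains_copy G (complete_graph m)"
  then obtain \<phi> where \<phi>: "inj_on \<phi> {..<m}" "\<phi> ` {..<m} \<subseteq> verts G"
    "\<And>e. e \<subseteq> {..<m} \<Longrightarrow> card e = 2 \<Longrightarrow> \<phi> ` e \<in> edges G"
    by (auto simp: contains_copy_def complete_graph_def)
  have "{u, v} \<in> edges G" if uv: "u \<in> \<phi> ` {..<m}" "v \<in> \<phi> ` {..<m}" "u \<noteq> v" for u v
  proof -
    obtain i j where ij: "i < m" "j < m" "u = \<phi> i" "v = \<phi> j" using uv by auto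
    then have "i \<noteq> j" using uv by auto
    then have "\<phi> ` {i, j} \<in> edges G" using ij by (intro \<phi>(3)) auto
    then show ?thesis using ij by simp
  qed
  then show "\<exists>A\<subseteq>verts G. card A = m \<and> (\<forall>u\<in>A. \<forall>v\<in>A. u \<noteq> v \<longrightarrow> {u, v} \<in> edges G)"
    using \<phi>(1,2) by (intro exI[of _ "\<phi> ` {..<m}"]) (auto simp: card_image)
next
  assume "\<exists>A\<subseteq>verts G. card A = m \<and> (\<forall>u\<in>A. \<forall>v\<in>A. u \<noteq> v \<longrightarrow> {u, v} \<in> edges G)"
  then obtain A where A: "A \<subseteq> verts G" "card A = m"
    "\<And>u v. u \<in> A \<Longrightarrow> v \<in> A \<Longrightarrow> u \<noteq> v \<Longrightarrow> {u, v} \<in> edges G" by blast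
  have "finite A" using A assms finite_subset by blast
  then obtain \<phi> where \<phi>: "bij_betw \<phi> {..<m} A"
    using A(2) ex_bij_betw_nat_finite[of A] by (auto simp: lessThan_atLeast0)
  have "\<phi> ` e \<in> edges G" if e: "e \<subseteq> {..<m}" "card e = 2" for e
  proof -
    obtain i j where ij: "e = {i, j}" "i \<noteq> j" using e(2) by (meson card_2_iff)
    then have "\<phi> i \<noteq> \<phi> j" "\<phi> i \<in> A" "\<phi> j \<in> A"
      using \<phi> e(1) by (auto simp: bij_betw_def inj_on_def)
    then show ?thesis using A(3) ij by simp
  qed
  then show "contains_copy G (complete_graph m)"
    using \<phi> A(1) unfolding contains_copy_def complete_graph_def
    by (intro exI[of _ \<phi>]) (auto simp: bij_betw_def)
qed

lemma indep_number_less: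
  assumes "finite (verts G)" "s > 0"
    and "\<And>W. W \<subseteq> verts G \<Longrightarrow> card W \<ge> w \<Longrightarrow>
      \<exists>A\<subseteq>W. card A = s \<and> (\<forall>u\<in>A. \<forall>v\<in>A. u \<noteq> v \<longrightarrow> {u, v} \<in> edges G)"
  shows "indep_number s G < w"
proof -
  let ?S = "{card W | W. W \<subseteq> verts G \<and> free_of (induced_subgraph G W) (complete_graph s)}"
  have "?S \<subseteq> card ` Pow (verts G)" by auto
  then have "finite ?S" using assms(1) finite_subset by blast
  moreover have "card {} \<in> ?S"
  proof -
    have "free_of (induced_subgraph G {}) (complete_graph s)"
      using assms(2) by (subst contains_complete_graph_iff) (auto simp: induced_subgraph_def)
    then show ?thesis by (intro CollectI exI[of _ "{}"]) simp
  qed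
  then have "?S \<noteq> {}" by blast
  moreover have "x < w" if "x \<in> ?S" for x
  proof (rule ccontr)
    assume "\<not> x < w"
    then obtain W where W: "W \<subseteq> verts G" "free_of (induced_subgraph G W) (complete_graph s)" "card W \<ge> w"
      using \<open>x \<in> ?S\<close> by auto
    obtain A where A: "A \<subseteq> W" "card A = s" "\<forall>u\<in>A. \<forall>v\<in>A. u \<noteq> v \<longrightarrow> {u, v} \<in> edges G"
      using assms(3)[OF W(1,3)] by blast
    have "finite W" using W(1) assms(1) finite_subset by blast
    then have "contains_copy (induced_subgraph G W) (complete_graph s)"
      using A by (subst contains_complete_graph_iff) (auto simp: induced_subgraph_def intro!: exI[of _ A])
    then show False using W(2) by blast
  qed
  ultimately show ?thesis unfolding indep_number_def by simp
qed

text \<open>\<open>RT_graphs\<close> may be infinite because vertices range over \<open>nat\<close>,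
  so boundedness of the edge counts is needed before \<open>Max\<close> can be used.\<close>

lemma card_edges_le_RT:
  assumes "G \<in> RT_graphs s n H f"
  shows "card (edges G) \<le> RT s n H f"
proof -
  have "card (edges G) \<le> 2 ^ n" if "G \<in> RT_graphs s n H f" for G
  proof -
    have G: "finite (verts G)" "edges G \<subseteq> Pow (verts G)" "card (verts G) = n"
      using that by (auto simp: RT_graphs_def simple_graph_def)
    then have "card (edges G) \<le> card (Pow (verts G))" by (intro card_mono) auto
    then show ?thesis using G by (simp add: card_Pow)
  qed
  then have "(\<lambda>G. card (edges G)) ` RT_graphs s n H f \<subseteq> {..2 ^ n}" by auto
  then have "finite ((\<lambda>G. card (edges G)) ` RT_graphs s n H f)" using finite_subset by blast
  then show ?thesis using assms by (auto simp: RT_def intro: Max_ge)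
qed

lemma card_pairs_le_edges:
  assumes "finite V"
  shows "card {(u, v) \<in> V \<times> V. adj u v} \<le> 2 * card (edges (graph_of V adj))"
proof -
  let ?E = "edges (graph_of V adj)"
  have "?E \<subseteq> Pow V" by (auto simp: graph_of_def)
  then have fin: "finite ?E" using assms finite_subset by blast
  have fib: "finite {(u, v). {u, v} = e} \<and> card {(u, v). {u, v} = e} \<le> 2" if e: "e \<in> ?E" for e
  proof -
    obtain a b where "e = {a, b}" using e by (auto simp: graph_of_def)
    then have sub: "{(u, v). {u, v} = e} \<subseteq> {(a, b), (b, a)}" by (auto simp: doubleton_eq_iff)
    then have "card {(u, v). {u, v} = e} \<le> card {(a, b), (b, a)}" by (intro card_mono) auto
    also have "\<dots> \<le> 2" using card_length[of "[(a, b), (b, a)]"] by simp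
    finally show ?thesis using sub finite_subset by blast
  qed
  have "{(u, v) \<in> V \<times> V. adj u v} \<subseteq> (\<Union>e\<in>?E. {(u, v). {u, v} = e})" by (auto simp: graph_of_def)
  then have "card {(u, v) \<in> V \<times> V. adj u v} \<le> card (\<Union>e\<in>?E. {(u, v). {u, v} = e})"
    using fin fib by (intro card_mono) auto
  also have "\<dots> \<le> (\<Sum>e\<in>?E. card {(u, v). {u, v} = e})" by (rule card_UN_le[OF fin])
  also have "\<dots> \<le> (\<Sum>e\<in>?E. 2)" using fib by (intro sum_mono) auto
  finally show ?thesis by simp
qed

section \<open>A graph from a good outcome\<close>

context random_lines
begin

text \<open>Three bad events below \<open>1 / (24 T K)\<close> total less than
  \<open>1 / (8 T K)\<close>, the mean number of ordered adjacent pairs is at least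
  \<open>N / (4 T K)\<close>, and no outcome has more than \<open>N\<close> of them. A good outcome
  keeps half of the mean, and passing from ordered pairs to edges halves again, whence 16.\<close>

lemma exists_graph:
  fixes M k r :: nat
  assumes "s > k + k * k * (M + r * r)" "M > 1" "V \<noteq> {}"
    and pairs: "(real (card V))\<^sup>2 / 2 \<le> real (card {(u, v) \<in> V \<times> V. collinear u v \<and> u \<noteq> v})"
    and cone: "real q ^ (2 + M + 2 * r) * ((1 / real T) * (1 / real K) ^ (M - 1) * (1 / real (T * K)) ^ (r * M))
      * (24 * real (T * K)) < 1"
    and scattered: "real q ^ (2 * k) * (1 / real (T * K)) ^ (k choose 2) * (24 * real (T * K)) < 1"
    and poor: "real q ^ (2 * (2 * q * (K * (2 * s\<^sup>2)))) * exp (- (real q ^ 2 / (16 * real T)))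
      * (24 * real (T * K)) < 1"
  shows "\<exists>G. simple_graph G \<and> verts G = V \<and> free_of G (complete_graph (s + r)) \<and>
    indep_number s G < 2 * q * (K * (2 * s\<^sup>2)) \<and>
    (real (card V))\<^sup>2 / (16 * real (T * K)) \<le> real (card (edges G))"
proof -
  let ?w = "2 * q * (K * (2 * s\<^sup>2))"
  let ?bad = "\<lambda>\<omega>. cone_clique M r \<omega> \<or> scattered_clique k \<omega> \<or> clique_poor ?w \<omega>"
  define N where "N = (real (card V))\<^sup>2"
  define D where "D = real (card {(u, v) \<in> V \<times> V. collinear u v \<and> u \<noteq> v})"
  define m where "m = D / (2 * real T * real K)"
  have TK: "real T > 0" "real K > 0" using T_pos K_pos by auto
  have N: "N > 0" using assms(3) finite_V by (simp add: N_def card_gt_0_iff)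
  have m: "m \<ge> N / (4 * real T * real K)"
    using pairs TK by (simp add: m_def N_def D_def field_simps)
  have m0: "m > 0" using m N TK by (meson divide_pos_pos less_le_trans mult_pos_pos zero_less_numeral)
  define c where "c = 1 / (24 * real T * real K)"
  have small: "x < c" if "y * (24 * real (T * K)) < 1" "x \<le> y" for x y
  proof -
    have "y < c" using that(1) TK by (simp add: c_def field_simps)
    then show ?thesis using that(2) by linarith
  qed
  have "freq outcomes ?bad \<le> freq outcomes (cone_clique M r) +
      (freq outcomes (scattered_clique k) + freq outcomes (clique_poor ?w))"
    by (rule order_trans[OF freq_disj_le add_left_mono[OF freq_disj_le]])
  also have "\<dots> < c + (c + c)"
  proof (intro add_strict_mono)
    show "freq outcomes (cone_clique M r) < c" using assms(2) by (intro small[OF cone freq_cone_clique]) simp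
    show "freq outcomes (scattered_clique k) < c" by (rule small[OF scattered freq_scattered_clique])
    show "freq outcomes (clique_poor ?w) < c" by (rule small[OF poor freq_clique_poor])
  qed
  also have "\<dots> = 1 / (8 * real T * real K)" by (simp add: c_def)
  finally have "N * freq outcomes ?bad < N * (1 / (8 * real T * real K))"
    using N by (rule mult_strict_left_mono)
  also have "\<dots> \<le> m / 2" using m by (simp add: mult_ac)
  finally have bad: "N * freq outcomes ?bad < m / 2" .
  have "\<exists>\<omega>\<in>outcomes. \<not> ?bad \<omega> \<and> real (card {(u, v) \<in> V \<times> V. adjacent \<omega> u v}) \<ge> m / 2"
  proof (rule exists_large_avoiding[OF finite_outcomes outcomes_nonempty _ _ bad m0])
    show "m * real (card outcomes) \<le> (\<Sum>\<omega>\<in>outcomes. real (card {(u, v) \<in> V \<times> V. adjacent \<omega> u v}))"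
      using sum_adjacent by (simp add: m_def D_def)
    show "real (card {(u, v) \<in> V \<times> V. adjacent \<omega> u v}) \<le> N" for \<omega>
    proof -
      have "card {(u, v) \<in> V \<times> V. adjacent \<omega> u v} \<le> card (V \<times> V)"
        using finite_V by (intro card_mono) auto
      then have "real (card {(u, v) \<in> V \<times> V. adjacent \<omega> u v}) \<le> real (card (V \<times> V))" by (rule of_nat_mono)
      then show ?thesis by (simp add: N_def card_cartesian_product power2_eq_square)
    qed
  qed
  then obtain \<omega> where good: "\<not> cone_clique M r \<omega>" "\<not> scattered_clique k \<omega>" "\<not> clique_poor ?w \<omega>"
    and many: "real (card {(u, v) \<in> V \<times> V. adjacent \<omega> u v}) \<ge> m / 2" by blast
  define G where "G = graph_of V (adjacent \<omega>)"
  have verts: "verts G = V" by (simp add: G_def graph_of_def)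
  have edge: "{u, v} \<in> edges G \<longleftrightarrow> adjacent \<omega> u v" for u v
  proof
    show "adjacent \<omega> u v" if "{u, v} \<in> edges G"
      using that adjacent_sym by (auto simp: G_def graph_of_def doubleton_eq_iff)
    show "{u, v} \<in> edges G" if "adjacent \<omega> u v"
      using that adjacent_in_V[OF that] by (auto simp: G_def graph_of_def)
  qed
  have "simple_graph G"
  proof -
    have "e \<subseteq> V \<and> card e = 2" if e: "e \<in> edges G" for e
    proof -
      obtain u v where uv: "e = {u, v}" "u \<in> V" "v \<in> V" "adjacent \<omega> u v"
        using e by (auto simp: G_def graph_of_def)
      then have "u \<noteq> v" using adjacent_irrefl by auto
      then show ?thesis using uv by simp
    qed
    then show ?thesis using verts finite_V by (simp add: simple_graph_def)
  qed
  moreover have "free_of G (complete_graph (s + r))"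
  proof
    assume "contains_copy G (complete_graph (s + r))"
    then obtain U where "U \<subseteq> V" "card U = s + r" "\<And>u v. u \<in> U \<Longrightarrow> v \<in> U \<Longrightarrow> u \<noteq> v \<Longrightarrow> adjacent \<omega> u v"
      using finite_V verts edge by (subst (asm) contains_complete_graph_iff) auto
    then show False using large_clique_cases[OF _ _ _ assms(1,2)] good by blast
  qed
  moreover have "indep_number s G < ?w"
    using not_clique_poor[OF good(3)] finite_V s_ge by (intro indep_number_less) (auto simp: verts edge)
  moreover have "N / (16 * real (T * K)) \<le> real (card (edges G))"
  proof -
    have "real (card {(u, v) \<in> V \<times> V. adjacent \<omega> u v}) \<le> real (2 * card (edges G))"
      unfolding G_def by (rule of_nat_mono[OF card_pairs_le_edges[OF finite_V]])
    then have "m / 4 \<le> real (card (edges G))" using many by simp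
    then show ?thesis using m by (simp add: mult_ac)
  qed
  ultimately show ?thesis using verts unfolding N_def by blast
qed

end

lemma exists_graph_affine:
  fixes q n T K s r M k :: nat
  assumes "prime q" "n \<le> q\<^sup>2" "2 * q \<le> n" "T > 0" "K > 0" "s \<ge> 2"
    and "s > k + k * k * (M + r * r)" "M > 1"
    and "real q ^ (2 + M + 2 * r) * ((1 / real T) * (1 / real K) ^ (M - 1) * (1 / real (T * K)) ^ (r * M))
      * (24 * real (T * K)) < 1"
    and "real q ^ (2 * k) * (1 / real (T * K)) ^ (k choose 2) * (24 * real (T * K)) < 1"
    and "real q ^ (2 * (2 * q * (K * (2 * s\<^sup>2)))) * exp (- (real q ^ 2 / (16 * real T)))
      * (24 * real (T * K)) < 1"
  shows "\<exists>G::nat ugraph. simple_graph G \<and> card (verts G) = n \<and> free_of G (complete_graph (s + r)) \<and>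
    indep_number s G < 2 * q * (K * (2 * s\<^sup>2)) \<and>
    (real n)\<^sup>2 / (16 * real (T * K)) \<le> real (card (edges G))"
proof -
  interpret line_system "{..<n}" "{..<q} \<times> {..<q}" "affine_line n q" q
    by (rule line_system_affine[OF assms(1,2)])
  interpret random_lines "{..<n}" "{..<q} \<times> {..<q}" "affine_line n q" q T K s
    by unfold_locales (use assms in auto)
  have "n > 0" using assms(1,3) prime_gt_0_nat[of q] by simp
  then have "{..<n} \<noteq> {}" by blast
  from exists_graph[OF assms(7,8) this _ assms(9,10,11)]
  show ?thesis using card_affine_collinear[OF assms(1-3)] by auto
qed

section \<open>Choice of parameters\<close>

text \<open>Two vertices are adjacent with probability about \<open>1 / (T K)\<close>, to be made \<open>q powr (- \<theta>)\<close>, while blocks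
  have about \<open>q / K\<close> points, to be made \<open>q powr (1 - \<eta>)\<close>.\<close>

lemma block_parameters:
  fixes q :: nat and \<eta> \<theta> :: real
  assumes "q \<ge> 1" "0 \<le> \<eta>" "\<eta> \<le> \<theta>"
  obtains K T :: nat where "K > 0" "T > 0" "real q powr \<eta> \<le> real K" "real K \<le> 2 * real q powr \<eta>"
    "real q powr \<theta> \<le> real (T * K)" "real (T * K) \<le> 3 * real q powr \<theta>"
    "real T \<le> 2 * real q powr (\<theta> - \<eta>)"
proof -
  define K where "K = nat \<lceil>real q powr \<eta>\<rceil>"
  define T where "T = nat \<lceil>real q powr \<theta> / real K\<rceil>"
  have q: "real q \<ge> 1" using assms by simp
  have e1: "real q powr \<eta> \<ge> 1" using q assms by (simp add: ge_one_powr_ge_zero)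
  have K1: "real q powr \<eta> \<le> real K" unfolding K_def by (rule real_nat_ceiling_ge)
  have K2: "real K \<le> real q powr \<eta> + 1" using e1 unfolding K_def by linarith
  have K0: "real K > 0" using K1 e1 by linarith
  have mono: "real q powr \<eta> \<le> real q powr \<theta>" using q assms by (simp add: powr_mono)
  have T1: "real q powr \<theta> / real K \<le> real T" unfolding T_def by (rule real_nat_ceiling_ge)
  have p0: "real q powr \<theta> / real K > 0" using K0 q by simp
  then have T2: "real T \<le> real q powr \<theta> / real K + 1" unfolding T_def by linarith
  have T0: "real T > 0" using T1 p0 by linarith
  have TK1: "real q powr \<theta> \<le> real (T * K)" using T1 K0 by (simp add: field_simps)
  have "real (T * K) \<le> real q powr \<theta> + real K" using T2 K0 by (simp add: field_simps)
  then have TK2: "real (T * K) \<le> 3 * real q powr \<theta>" using K2 mono e1 by linarith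
  have "real q powr \<theta> / real K \<le> real q powr \<theta> / real q powr \<eta>"
    using K1 K0 q by (intro divide_left_mono mult_pos_pos) auto
  also have "\<dots> = real q powr (\<theta> - \<eta>)" by (simp add: powr_diff)
  finally have "real T \<le> real q powr (\<theta> - \<eta>) + 1" using T2 by linarith
  moreover have "real q powr (\<theta> - \<eta>) \<ge> 1" using q assms by (simp add: ge_one_powr_ge_zero)
  ultimately have "real T \<le> 2 * real q powr (\<theta> - \<eta>)" by linarith
  moreover have "real K \<le> 2 * real q powr \<eta>" using K2 e1 by linarith
  ultimately show ?thesis using that[of K T] K0 T0 K1 TK1 TK2 by simp
qed

text \<open>The exponent of \<open>Q\<close> is 2 + 2 r + \<eta> + \<theta> - M r \<epsilon>, at
  most -1 by the choice of \<open>M\<close>. The constant 144 is 24 times the factors 3 and 2 from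
  the rounding of \<open>T * K\<close> and of \<open>K\<close>.\<close>

lemma cone_probability_small:
  fixes Q \<eta> \<theta> \<epsilon> :: real and K T M r :: nat
  assumes "Q > 144" "0 \<le> \<eta>" "\<eta> \<le> 1" "\<theta> \<le> 1" "K > 0" "T > 0" "M > 0"
    and "\<eta> + \<theta> * real r = 1 + real r * \<epsilon>" "real M * (real r * \<epsilon>) \<ge> 2 * real r + 5"
    and K: "Q powr \<eta> \<le> real K" "real K \<le> 2 * Q powr \<eta>"
    and TK: "Q powr \<theta> \<le> real (T * K)" "real (T * K) \<le> 3 * Q powr \<theta>"
  shows "Q ^ (2 + M + 2 * r) * ((1 / real T) * (1 / real K) ^ (M - 1) * (1 / real (T * K)) ^ (r * M))
    * (24 * real (T * K)) < 1"
proof -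
  have Q: "Q > 0" using assms by simp
  have T1: "1 / real T \<le> 1" using assms by simp
  have "1 / real K \<le> Q powr (- \<eta>)"
    using K Q assms by (simp add: powr_minus_divide frac_le)
  then have "(1 / real K) ^ M \<le> (Q powr (- \<eta>)) ^ M" by (intro power_mono) auto
  also have "\<dots> = Q powr (- \<eta> * real M)" using Q by (simp add: powr_powr flip: powr_realpow)
  finally have K1: "(1 / real K) ^ M \<le> Q powr (- \<eta> * real M)" .
  have "(1 / real K) ^ (M - 1) = real K * (1 / real K) ^ M"
    using assms by (cases M) auto
  also have "\<dots> \<le> 2 * Q powr \<eta> * Q powr (- \<eta> * real M)"
    using K K1 by (intro mult_mono) auto
  finally have K2: "(1 / real K) ^ (M - 1) \<le> 2 * Q powr \<eta> * Q powr (- \<eta> * real M)" .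
  have "1 / real (T * K) \<le> Q powr (- \<theta>)"
    using TK(1) Q assms by (simp add: powr_minus_divide frac_le del: of_nat_mult)
  then have "(1 / real (T * K)) ^ (r * M) \<le> (Q powr (- \<theta>)) ^ (r * M)" by (intro power_mono) auto
  also have "\<dots> = Q powr (- \<theta> * real (r * M))" using Q by (simp add: powr_powr flip: powr_realpow)
  finally have TK1: "(1 / real (T * K)) ^ (r * M) \<le> Q powr (- \<theta> * real (r * M))" .
  have Q1: "Q ^ (2 + M + 2 * r) = Q powr real (2 + M + 2 * r)" using Q by (simp only: powr_realpow)
  have "Q ^ (2 + M + 2 * r) * ((1 / real T) * (1 / real K) ^ (M - 1) * (1 / real (T * K)) ^ (r * M)) * (24 * real (T * K))
      \<le> Q powr real (2 + M + 2 * r) * (1 * (2 * Q powr \<eta> * Q powr (- \<eta> * real M)) * Q powr (- \<theta> * real (r * M)))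
        * (24 * (3 * Q powr \<theta>))"
    unfolding Q1 using T1 K2 TK1 TK(2) by (intro mult_mono) auto
  also have "\<dots> = 144 * (Q powr real (2 + M + 2 * r) * Q powr \<eta> * Q powr (- \<eta> * real M) *
      Q powr (- \<theta> * real (r * M)) * Q powr \<theta>)"
    by (simp add: mult_ac)
  also have "\<dots> = 144 * Q powr (real (2 + M + 2 * r) + \<eta> + (- \<eta> * real M) + (- \<theta> * real (r * M)) + \<theta>)"
    by (simp only: powr_add)
  also have "\<dots> \<le> 144 * Q powr (- 1)"
  proof -
    have "- \<eta> * real M + - \<theta> * real (r * M) = - real M * (\<eta> + \<theta> * real r)"
      by (simp add: algebra_simps)
    also have "\<dots> = - real M - real M * (real r * \<epsilon>)"
      unfolding assms(8) by (simp add: algebra_simps)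
    finally have "- \<eta> * real M + - \<theta> * real (r * M) \<le> - real M - (2 * real r + 5)"
      using assms(9) by linarith
    then have "real (2 + M + 2 * r) + \<eta> + (- \<eta> * real M) + (- \<theta> * real (r * M)) + \<theta> \<le> - 1"
      using assms(3,4) by simp
    then show ?thesis using assms(1) by (intro mult_left_mono powr_mono) auto
  qed
  also have "\<dots> < 1" using assms(1) by (simp add: powr_minus_divide)
  finally show ?thesis .
qed

text \<open>The condition on \<open>k\<close> makes \<theta> times \<open>k choose 2\<close> at
  least \<open>3 * k\<close>, so the exponent of \<open>Q\<close> is at most \<open>1 - k\<close>,
  and \<open>k \<ge> 2\<close> brings it to -1.\<close>

lemma scattered_probability_small:
  fixes Q \<theta> :: real and K T k :: nat
  assumes "Q > 144" "\<theta> \<le> 1" "K > 0" "T > 0" "\<theta> * (real k - 1) \<ge> 6" "k \<ge> 2"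
    and TK: "Q powr \<theta> \<le> real (T * K)" "real (T * K) \<le> 3 * Q powr \<theta>"
  shows "Q ^ (2 * k) * (1 / real (T * K)) ^ (k choose 2) * (24 * real (T * K)) < 1"
proof -
  have Q: "Q > 0" using assms by simp
  have "1 / real (T * K) \<le> Q powr (- \<theta>)"
    using TK(1) Q assms by (simp add: powr_minus_divide frac_le del: of_nat_mult)
  then have "(1 / real (T * K)) ^ (k choose 2) \<le> (Q powr (- \<theta>)) ^ (k choose 2)" by (intro power_mono) auto
  also have "\<dots> = Q powr (- \<theta> * real (k choose 2))" using Q by (simp add: powr_powr flip: powr_realpow)
  finally have TK1: "(1 / real (T * K)) ^ (k choose 2) \<le> Q powr (- \<theta> * real (k choose 2))" .
  have Q1: "Q ^ (2 * k) = Q powr real (2 * k)" using Q by (simp only: powr_realpow)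
  have "Q ^ (2 * k) * (1 / real (T * K)) ^ (k choose 2) * (24 * real (T * K))
      \<le> Q powr real (2 * k) * Q powr (- \<theta> * real (k choose 2)) * (24 * (3 * Q powr \<theta>))"
    unfolding Q1 using TK1 TK(2) by (intro mult_mono) auto
  also have "\<dots> = 72 * (Q powr real (2 * k) * Q powr (- \<theta> * real (k choose 2)) * Q powr \<theta>)"
    by (simp add: mult_ac)
  also have "\<dots> = 72 * Q powr (real (2 * k) + (- \<theta> * real (k choose 2)) + \<theta>)"
    by (simp only: powr_add)
  also have "\<dots> \<le> 72 * Q powr (- 1)"
  proof -
    have "even (k * (k - 1))" by (cases "even k") auto
    then have "real (k choose 2) = real (k * (k - 1)) / 2"
      unfolding choose_two by (simp add: real_of_nat_div)
    then have c: "real (k choose 2) = real k * (real k - 1) / 2" using assms(6) by (simp add: of_nat_diff)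
    have "real k * 6 \<le> real k * (\<theta> * (real k - 1))" using assms(5) by (intro mult_left_mono) auto
    then have "\<theta> * real (k choose 2) \<ge> 3 * real k" unfolding c by (simp add: mult_ac)
    then have "real (2 * k) + (- \<theta> * real (k choose 2)) + \<theta> \<le> - 1"
      using assms(2,6) by simp
    then show ?thesis using assms(1) by (intro mult_left_mono powr_mono) auto
  qed
  also have "\<dots> < 1" using assms(1) by (simp add: powr_minus_divide)
  finally show ?thesis .
qed

text \<open>All three factors are written as exponentials of multiples of \<open>ln q\<close>, or of
  a power of \<open>q\<close> for the gain: the number of sets costs at most
  \<open>16 s^2 q powr (1 + \<eta>)\<close> times \<open>ln q\<close>, and the bound on
  \<open>T\<close> makes the gain at least
  \<open>q powr (2 - \<theta> + \<eta>) / 32\<close>.\<close>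

lemma poor_probability_small:
  fixes \<eta> \<theta> :: real and q K T s :: nat
  assumes "q \<ge> 1" "\<theta> \<le> 1" "K > 0" "T > 0"
    and K: "real K \<le> 2 * real q powr \<eta>" and T: "real T \<le> 2 * real q powr (\<theta> - \<eta>)"
    and TK: "real (T * K) \<le> 3 * real q powr \<theta>"
    and ev: "(16 * (real s)\<^sup>2 * real q powr (1 + \<eta>) + 1) * ln (real q) + ln 72 < real q powr (2 - \<theta> + \<eta>) / 32"
  shows "real q ^ (2 * (2 * q * (K * (2 * s\<^sup>2)))) * exp (- (real q ^ 2 / (16 * real T))) * (24 * real (T * K)) < 1"
proof -
  define Q where "Q = real q"
  have Q: "Q \<ge> 1" using assms(1) by (simp add: Q_def)
  then have lnQ: "ln Q \<ge> 0" by simp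
  let ?w = "2 * (2 * q * (K * (2 * s\<^sup>2)))"
  have "real ?w = 8 * (real s)\<^sup>2 * (Q * real K)" by (simp add: Q_def)
  also have "\<dots> \<le> 8 * (real s)\<^sup>2 * (Q * (2 * Q powr \<eta>))"
    using K Q by (intro mult_left_mono) (auto simp: Q_def)
  also have "\<dots> = 16 * (real s)\<^sup>2 * Q powr (1 + \<eta>)" using Q by (simp add: powr_add)
  finally have "real ?w * ln Q \<le> 16 * (real s)\<^sup>2 * Q powr (1 + \<eta>) * ln Q"
    using lnQ by (rule mult_right_mono)
  moreover have "Q ^ ?w = exp (real ?w * ln Q)"
    using Q by (simp only: exp_of_nat_mult) (simp add: power_mult)
  ultimately have 1: "Q ^ ?w \<le> exp (16 * (real s)\<^sup>2 * Q powr (1 + \<eta>) * ln Q)" by simp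
  have "Q powr (2 - \<theta> + \<eta>) / 32 = Q ^ 2 / (16 * (2 * Q powr (\<theta> - \<eta>)))"
    using Q by (simp add: powr_add powr_diff)
  also have "\<dots> \<le> Q ^ 2 / (16 * real T)"
    using T assms(1,4) by (intro divide_left_mono mult_pos_pos) (auto simp: Q_def)
  finally have 2: "exp (- (Q ^ 2 / (16 * real T))) \<le> exp (- (Q powr (2 - \<theta> + \<eta>) / 32))" by simp
  have "24 * real (T * K) \<le> 72 * Q powr 1"
    using TK powr_mono[OF assms(2) Q] unfolding Q_def by linarith
  also have "\<dots> = exp (ln 72 + ln Q)" using Q by (simp add: exp_add)
  finally have 3: "24 * real (T * K) \<le> exp (ln 72 + ln Q)" .
  have "Q ^ ?w * exp (- (Q ^ 2 / (16 * real T))) * (24 * real (T * K))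
    \<le> exp (16 * (real s)\<^sup>2 * Q powr (1 + \<eta>) * ln Q) * exp (- (Q powr (2 - \<theta> + \<eta>) / 32)) * exp (ln 72 + ln Q)"
    using 1 2 3 Q by (intro mult_mono) auto
  also have "\<dots> = exp ((16 * (real s)\<^sup>2 * Q powr (1 + \<eta>) + 1) * ln Q + ln 72 - Q powr (2 - \<theta> + \<eta>) / 32)"
    by (simp add: exp_add[symmetric] algebra_simps del: exp_ln)
  also have "\<dots> < 1" using ev by (simp add: Q_def)
  finally show ?thesis by (simp add: Q_def)
qed

text \<open>Applied with \<open>a = 1 + \<eta>\<close> and \<open>b = 2 - \<theta> + \<eta>\<close>,
  where \<open>a < b\<close> says exactly \<theta> < 1.\<close>

lemma eventually_poor_condition:
  fixes c a b :: real
  assumes "a < b" "0 \<le> a"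
  shows "\<forall>\<^sub>F q :: nat in sequentially. (c * real q powr a + 1) * ln (real q) + ln 72 < real q powr b / 32"
proof -
  have lim: "((\<lambda>q. real q powr (- d) * ln (real q)) \<longlongrightarrow> 0) sequentially" "((\<lambda>q. real q powr (- d)) \<longlongrightarrow> 0) sequentially"
    if "d > 0" for d :: real
    using that by real_asymp+
  have "((\<lambda>q. c * (real q powr (- (b - a)) * ln (real q)) + real q powr (- b) * ln (real q) + ln 72 * real q powr (- b))
      \<longlongrightarrow> c * 0 + 0 + ln 72 * 0) sequentially"
    using assms by (intro tendsto_add tendsto_mult_left lim) auto
  then have "\<forall>\<^sub>F q in sequentially. c * (real q powr (- (b - a)) * ln (real q)) + real q powr (- b) * ln (real q)
      + ln 72 * real q powr (- b) < 1 / 32"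
    by (rule order_tendstoD) simp
  then show ?thesis using eventually_gt_at_top[of 0]
  proof eventually_elim
    case (elim q)
    have "(c * (real q powr (- (b - a)) * ln (real q)) + real q powr (- b) * ln (real q)
      + ln 72 * real q powr (- b)) * real q powr b < 1 / 32 * real q powr b"
      using elim by (intro mult_strict_right_mono) auto
    also have "(c * (real q powr (- (b - a)) * ln (real q)) + real q powr (- b) * ln (real q)
        + ln 72 * real q powr (- b)) * real q powr b
      = c * (real q powr (- (b - a)) * real q powr b) * ln (real q)
        + (real q powr (- b) * real q powr b) * ln (real q) + ln 72 * (real q powr (- b) * real q powr b)"
      by (simp only: algebra_simps)
    also have "real q powr (- (b - a)) * real q powr b = real q powr a"
      by (simp flip: powr_add)
    also have "real q powr (- b) * real q powr b = 1"
      using elim by (simp flip: powr_add)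
    finally show ?case by (simp add: algebra_simps)
  qed
qed

text \<open>\<open>M\<close> and \<open>k\<close> are fixed before \<open>s\<close>, and the
  threshold \<open>q0\<close> only after it, in accordance with the nested quantifiers. The
  condition on \<eta> and \<open>r\<close> says \<eta> \<le> (1 - \<eta>) / r, which ensures \<eta>
  \<le> \<theta>. The constant 200 is 8 times 25, the added 1 makes the bound strict, and 240 is 16
  times 15.\<close>

lemma eventually_RT_graph:
  fixes r :: nat and \<eta> \<epsilon> \<theta> :: real
  assumes "r \<ge> 1" "0 \<le> \<eta>" "\<eta> * (real r + 1) \<le> 1" "\<epsilon> > 0"
    and \<theta>: "\<theta> = (1 - \<eta>) / real r + \<epsilon>" "\<theta> < 1"
  shows "\<forall>\<^sub>F s in sequentially. \<forall>\<^sub>F n in sequentially.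
    \<exists>G\<in>RT_graphs s n (complete_graph (s + r)) (\<lambda>m. (200 * (real s)\<^sup>2 + 1) * real m powr ((1 + \<eta>) / 2)).
      real n powr (2 - \<theta> / 2) / 240 \<le> real (card (edges G))"
proof -
  have r: "real r > 0" using assms by simp
  have \<eta>1: "\<eta> \<le> 1" using assms(1-3) by (smt (verit) mult_left_mono mult_cancel_left1 of_nat_0_le_iff)
  have "\<eta> \<le> (1 - \<eta>) / real r" using assms(3) r by (simp add: field_simps)
  then have \<eta>\<theta>: "\<eta> \<le> \<theta>" using \<theta> assms(4) by linarith
  have \<theta>0: "\<theta> > 0"
    using \<theta>(1) assms(4) \<eta>1 r by (simp add: add_nonneg_pos)
  have eq: "\<eta> + \<theta> * real r = 1 + real r * \<epsilon>" using \<theta>(1) r by (simp add: field_simps)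
  obtain M0 :: nat where M0: "(2 * real r + 5) / (real r * \<epsilon>) \<le> real M0" using real_arch_simple by blast
  define M where "M = M0 + 2"
  have M: "M > 1" "real M * (real r * \<epsilon>) \<ge> 2 * real r + 5"
  proof -
    have "(2 * real r + 5) / (real r * \<epsilon>) \<le> real M" using M0 by (simp add: M_def)
    then show "real M * (real r * \<epsilon>) \<ge> 2 * real r + 5"
      using r assms(4) by (simp add: pos_divide_le_eq)
  qed (simp add: M_def)
  obtain k0 :: nat where k0: "6 / \<theta> \<le> real k0" using real_arch_simple by blast
  define k where "k = k0 + 2"
  have k: "k \<ge> 2" "\<theta> * (real k - 1) \<ge> 6"
  proof -
    have "6 / \<theta> \<le> real k - 1" using k0 by (simp add: k_def)
    then show "\<theta> * (real k - 1) \<ge> 6" using \<theta>0 by (simp add: pos_divide_le_eq mult_ac)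
  qed (simp add: k_def)
  show ?thesis
    using eventually_gt_at_top[of "k + k * k * (M + r * r) + 2"]
  proof eventually_elim
    case (elim s)
    have "\<forall>\<^sub>F q :: nat in sequentially. (16 * (real s)\<^sup>2 * real q powr (1 + \<eta>) + 1) * ln (real q) + ln 72
        < real q powr (2 - \<theta> + \<eta>) / 32"
      using \<theta>(2) assms(2) by (intro eventually_poor_condition) auto
    then obtain q0 where q0: "\<And>q. q \<ge> q0 \<Longrightarrow>
      (16 * (real s)\<^sup>2 * real q powr (1 + \<eta>) + 1) * ln (real q) + ln 72 < real q powr (2 - \<theta> + \<eta>) / 32"
      unfolding eventually_sequentially by blast
    show ?case
      \<comment> \<open>The square is passed on from \<open>n\<close> to \<open>q\<close>: it forces
        \<open>q \<ge> q0 + 145\<close>, beyond \<open>q0\<close> and beyond the constant 144 at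
        once.\<close>
      using eventually_prime_sqrt eventually_ge_at_top[of "(q0 + 145)\<^sup>2"]
    proof eventually_elim
      case (elim n)
      then obtain q where q: "prime q" "n \<le> q\<^sup>2" "q\<^sup>2 \<le> 25 * n" by blast
      have "(q0 + 145)\<^sup>2 \<le> q\<^sup>2" using elim q by linarith
      then have qge: "q0 + 145 \<le> q" by (rule power2_le_imp_le) simp
      have qn: "2 * q \<le> n"
      proof -
        have "50 * q \<le> q * q" using qge by (intro mult_right_mono) auto
        then show ?thesis using q(3) unfolding power2_eq_square by linarith
      qed
      have q1: "q \<ge> 1" using qge by simp
      obtain K T where KT: "K > 0" "T > 0" "real q powr \<eta> \<le> real K" "real K \<le> 2 * real q powr \<eta>"
        "real q powr \<theta> \<le> real (T * K)" "real (T * K) \<le> 3 * real q powr \<theta>" "real T \<le> 2 * real q powr (\<theta> - \<eta>)"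
        by (rule block_parameters[OF q1 assms(2) \<eta>\<theta>])
      have Q: "real q > 144" using qge by simp
      have sl: "s > k + k * k * (M + r * r)" "s \<ge> 2" using \<open>k + k * k * (M + r * r) + 2 < s\<close> by auto
      obtain G :: "nat ugraph" where G: "simple_graph G" "card (verts G) = n" "free_of G (complete_graph (s + r))"
        "indep_number s G < 2 * q * (K * (2 * s\<^sup>2))" "(real n)\<^sup>2 / (16 * real (T * K)) \<le> real (card (edges G))"
        using exists_graph_affine[OF q(1,2) qn KT(2,1) sl(2,1) M(1)
            cone_probability_small[OF Q assms(2) \<eta>1 less_imp_le[OF \<theta>(2)] KT(1,2) _ eq M(2) KT(3-6)]
            scattered_probability_small[OF Q less_imp_le[OF \<theta>(2)] KT(1,2) k(2,1) KT(5,6)]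
            poor_probability_small[OF q1 less_imp_le[OF \<theta>(2)] KT(1,2,4,7,6) q0]] M(1) qge
        by auto
      have n0: "real n > 0" using qn qge by simp
      have q5: "real q \<le> 5 * real n powr (1 / 2)"
      proof -
        have "real (q\<^sup>2) \<le> real (25 * n)" using q(3) by (rule of_nat_mono)
        then have "(real q)\<^sup>2 \<le> (5 * sqrt (real n))\<^sup>2" by (simp add: power_mult_distrib)
        then have "real q \<le> 5 * sqrt (real n)" by (rule power2_le_imp_le) simp
        then show ?thesis by (simp add: powr_half_sqrt)
      qed
      have qpow: "real q powr x \<le> 5 powr x * real n powr (x / 2)" if "x \<ge> 0" for x
      proof -
        have "real q powr x \<le> (5 * real n powr (1 / 2)) powr x" using q5 that by (intro powr_mono2) auto
        then show ?thesis by (simp add: powr_mult powr_powr)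
      qed
      have "real (indep_number s G) \<le> real (2 * q * (K * (2 * s\<^sup>2)))"
        by (rule of_nat_mono[OF less_imp_le[OF G(4)]])
      also have "\<dots> = 4 * (real s)\<^sup>2 * (real q * real K)" by simp
      also have "\<dots> \<le> 4 * (real s)\<^sup>2 * (real q * (2 * real q powr \<eta>))"
        using KT(4) by (intro mult_left_mono) auto
      also have "\<dots> = 8 * (real s)\<^sup>2 * real q powr (1 + \<eta>)" using Q by (simp add: powr_add)
      also have "\<dots> \<le> 8 * (real s)\<^sup>2 * (25 * real n powr ((1 + \<eta>) / 2))"
      proof -
        have "(5::real) powr (1 + \<eta>) \<le> 5 powr 2" using \<eta>1 by (intro powr_mono) auto
        then have "5 powr (1 + \<eta>) * real n powr ((1 + \<eta>) / 2) \<le> 25 * real n powr ((1 + \<eta>) / 2)"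
          by (intro mult_right_mono) auto
        then show ?thesis using qpow[of "1 + \<eta>"] assms(2) by (intro mult_left_mono) auto
      qed
      also have "\<dots> < (200 * (real s)\<^sup>2 + 1) * real n powr ((1 + \<eta>) / 2)"
        using n0 by (simp add: algebra_simps)
      finally have indep: "real (indep_number s G) < (200 * (real s)\<^sup>2 + 1) * real n powr ((1 + \<eta>) / 2)" .
      have "real q powr \<theta> \<le> 5 * real n powr (\<theta> / 2)"
      proof -
        have "(5::real) powr \<theta> \<le> 5 powr 1" using \<theta>(2) by (intro powr_mono) auto
        then have "5 powr \<theta> * real n powr (\<theta> / 2) \<le> 5 * real n powr (\<theta> / 2)"
          by (intro mult_right_mono) auto
        then show ?thesis using qpow[of \<theta>] \<theta>0 by linarith
      qed
      then have TK: "real (T * K) \<le> 15 * real n powr (\<theta> / 2)" using KT(6) by linarith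
      have "real n powr (2 - \<theta> / 2) / 240 = (real n)\<^sup>2 / (16 * (15 * real n powr (\<theta> / 2)))"
        using n0 by (simp add: powr_diff)
      also have "\<dots> \<le> (real n)\<^sup>2 / (16 * real (T * K))"
        using TK KT(1,2) n0 by (intro divide_left_mono mult_left_mono mult_pos_pos) auto
      finally have "real n powr (2 - \<theta> / 2) / 240 \<le> real (card (edges G))" using G(5) by linarith
      then show ?case using G(1-3) indep unfolding RT_graphs_def by blast
    qed
  qed
qed

text \<open>A larger bound on the independence number only admits more graphs. Comparing
  \<open>f\<close> and \<open>g\<close> eventually is what allows a constant depending on
  \<open>s\<close> to be traded for a small power of \<open>n\<close>.\<close>

lemma RT_in_bigomega:
  assumes "\<forall>\<^sub>F n in sequentially. \<exists>G\<in>RT_graphs s n H f. real n powr e / 240 \<le> real (card (edges G))"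
    and "\<forall>\<^sub>F n in sequentially. f n \<le> g n" "e' \<le> e"
  shows "(\<lambda>n. real (RT s n H g)) \<in> \<Omega>(\<lambda>n. real n powr e')"
proof (rule landau_omega.bigI[where c = "1 / 240"])
  show "\<forall>\<^sub>F n in sequentially. 1 / 240 * norm (real n powr e') \<le> norm (real (RT s n H g))"
    using assms(1,2) eventually_ge_at_top[of 1]
  proof eventually_elim
    case (elim n)
    then obtain G where G: "G \<in> RT_graphs s n H f" "real n powr e / 240 \<le> real (card (edges G))" by blast
    then have "G \<in> RT_graphs s n H g" using elim(2) by (auto simp: RT_graphs_def)
    then have "real (card (edges G)) \<le> real (RT s n H g)" by (intro of_nat_mono card_edges_le_RT)
    moreover have "real n powr e' \<le> real n powr e" using elim(3) assms(3) by (intro powr_mono) auto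
    ultimately show ?case using G(2) by simp
  qed
qed simp

theorem theorem3p3:
  fixes r :: nat and \<epsilon> \<delta> :: real
  assumes "r \<ge> 1" and "\<epsilon> > 0"
    and "1 / 2 < \<delta>" and "\<delta> \<le> 1 / 2 + 1 / (2 * (2 * real r + 1))"
  shows "(\<forall>\<^sub>F s in sequentially.
            (\<lambda>n. real (RT s n (complete_graph (s + r)) (\<lambda>m. real m powr \<delta>)))
              \<in> \<Omega>(\<lambda>n. real n powr (2 - (1 - \<delta>) / real r - \<epsilon>))) \<and>
         (r \<ge> 2 \<longrightarrow>
           (\<exists>C :: nat \<Rightarrow> real. (\<forall>s. C s > 0) \<and>
             (\<forall>\<^sub>F s in sequentially.
               (\<lambda>n. real (RT s n (complete_graph (s + r)) (\<lambda>m. C s * sqrt (real m))))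
                 \<in> \<Omega>(\<lambda>n. real n powr (2 - 1 / (2 * real r) - \<epsilon>)))))"
proof
  have r: "real r \<ge> 1" using assms(1) by simp
  \<comment> \<open>Taking \<open>(1 + \<eta>) / 2\<close> below \<open>\<delta>\<close> by \<open>\<sigma>\<close> absorbs the factor depending on \<open>s\<close>.\<close>
  define \<sigma> where "\<sigma> = min (\<epsilon> / 2) (\<delta> / 2 - 1 / 4)"
  define \<eta> where "\<eta> = 2 * \<delta> - 1 - 2 * \<sigma>"
  \<comment> \<open>For r = 1 the value of \<theta> is 1 - \<eta> + \<epsilon>', so \<epsilon>' has
    to stay below \<eta> to keep \<theta> < 1.\<close>
  define \<epsilon>' where "\<epsilon>' = min \<epsilon> (\<eta> / 2)"
  define \<theta> where "\<theta> = (1 - \<eta>) / real r + \<epsilon>'"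
  have \<sigma>0: "\<sigma> > 0" using assms(2,3) by (simp add: \<sigma>_def)
  have \<sigma>1: "\<sigma> \<le> \<epsilon> / 2" unfolding \<sigma>_def by (rule min.cobounded1)
  have \<sigma>2: "\<sigma> \<le> \<delta> / 2 - 1 / 4" unfolding \<sigma>_def by (rule min.cobounded2)
  \<comment> \<open>The second term in the minimum defining \<sigma> gives \<eta> \<ge> \<delta> -
    1/2.\<close>
  have \<eta>0: "\<eta> > 0" using \<sigma>2 assms(3) by (simp add: \<eta>_def)
  have "(2 * \<delta> - 1) * (2 * real r + 1) \<le> 1" using assms(4) r by (simp add: field_simps)
  moreover have "\<eta> * (real r + 1) \<le> (2 * \<delta> - 1) * (2 * real r + 1)"
    using \<sigma>0 assms(3) r by (intro mult_mono) (auto simp: \<eta>_def)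
  ultimately have \<eta>r: "\<eta> * (real r + 1) \<le> 1" by linarith
  have "\<eta> * 1 \<le> \<eta> * (real r + 1)" using \<eta>0 r by (intro mult_left_mono) auto
  then have \<eta>1: "\<eta> \<le> 1" using \<eta>r by linarith
  have \<epsilon>': "\<epsilon>' > 0" "\<epsilon>' \<le> \<epsilon>" using assms(2) \<eta>0 by (auto simp: \<epsilon>'_def)
  have \<epsilon>'\<eta>: "\<epsilon>' \<le> \<eta> / 2" unfolding \<epsilon>'_def by (rule min.cobounded2)
  have "(1 - \<eta>) / real r \<le> 1 - \<eta>" using \<eta>1 r by (simp add: pos_divide_le_eq mult_le_cancel_left1)
  then have \<theta>1: "\<theta> < 1" using \<epsilon>'\<eta> \<eta>0 unfolding \<theta>_def by linarith
  have "\<theta> / 2 = (1 - \<delta>) / real r + \<sigma> / real r + \<epsilon>' / 2"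
    by (simp add: \<theta>_def \<eta>_def add_divide_distrib diff_divide_distrib)
  moreover have "\<sigma> / real r \<le> \<sigma>" using \<sigma>0 r by (simp add: pos_divide_le_eq mult_le_cancel_left1)
  ultimately have exponent: "2 - (1 - \<delta>) / real r - \<epsilon> \<le> 2 - \<theta> / 2" using \<sigma>1 \<epsilon>'(2) by linarith
  have half: "(1 + \<eta>) / 2 = \<delta> - \<sigma>" by (simp add: \<eta>_def)
  show "\<forall>\<^sub>F s in sequentially. (\<lambda>n. real (RT s n (complete_graph (s + r)) (\<lambda>m. real m powr \<delta>)))
      \<in> \<Omega>(\<lambda>n. real n powr (2 - (1 - \<delta>) / real r - \<epsilon>))"
    using eventually_RT_graph[OF assms(1) less_imp_le[OF \<eta>0] \<eta>r \<epsilon>'(1) \<theta>_def \<theta>1]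
  proof eventually_elim
    case (elim s)
    have "\<forall>\<^sub>F n :: nat in sequentially. (200 * (real s)\<^sup>2 + 1) * real n powr (\<delta> - \<sigma>) \<le> real n powr \<delta>"
    proof -
      have "filterlim (\<lambda>n :: nat. real n powr \<sigma>) at_top sequentially" using \<sigma>0 by real_asymp
      then have "\<forall>\<^sub>F n :: nat in sequentially. 200 * (real s)\<^sup>2 + 1 \<le> real n powr \<sigma>"
        by (simp add: filterlim_at_top)
      then show ?thesis
      proof eventually_elim
        case (elim n)
        then have "(200 * (real s)\<^sup>2 + 1) * real n powr (\<delta> - \<sigma>) \<le> real n powr \<sigma> * real n powr (\<delta> - \<sigma>)"
          by (rule mult_right_mono) simp
        then show ?case by (simp flip: powr_add)
      qed
    qed
    then show ?case using elim exponent unfolding half by (intro RT_in_bigomega) auto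
  qed
next
  show "r \<ge> 2 \<longrightarrow>
           (\<exists>C :: nat \<Rightarrow> real. (\<forall>s. C s > 0) \<and>
             (\<forall>\<^sub>F s in sequentially.
               (\<lambda>n. real (RT s n (complete_graph (s + r)) (\<lambda>m. C s * sqrt (real m))))
                 \<in> \<Omega>(\<lambda>n. real n powr (2 - 1 / (2 * real r) - \<epsilon>))))"
  \<comment> \<open>The witness is the constant of \<open>eventually_RT_graph\<close> at \<eta> = 0.
    The bound is now exactly of order sqrt n, so there is no room to absorb it and it depends on
    \<open>s\<close>.\<close>
  proof (intro impI exI[of _ "\<lambda>s. 200 * (real s)\<^sup>2 + 1"] conjI allI)
    assume r: "r \<ge> 2"
    show "200 * (real s)\<^sup>2 + 1 > 0" for s by (simp add: add_nonneg_pos)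
    \<comment> \<open>With \<eta> = 0 and r \<ge> 2 the cap 1/4 gives \<theta> \<le> 3/4.\<close>
    define \<epsilon>' where "\<epsilon>' = min \<epsilon> (1 / 4)"
    define \<theta> where "\<theta> = (1 - 0) / real r + \<epsilon>'"
    have \<epsilon>': "\<epsilon>' > 0" "\<epsilon>' \<le> \<epsilon>" "\<epsilon>' \<le> 1 / 4" using assms(2) by (auto simp: \<epsilon>'_def)
    have "1 / real r \<le> 1 / 2" using r by (simp add: field_simps)
    then have \<theta>1: "\<theta> < 1" using \<epsilon>'(3) unfolding \<theta>_def diff_zero by linarith
    have exponent: "2 - 1 / (2 * real r) - \<epsilon> \<le> 2 - \<theta> / 2"
      using \<epsilon>'(1,2) by (simp add: \<theta>_def add_divide_distrib)
    show "\<forall>\<^sub>F s in sequentially.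
        (\<lambda>n. real (RT s n (complete_graph (s + r)) (\<lambda>m. (200 * (real s)\<^sup>2 + 1) * sqrt (real m))))
          \<in> \<Omega>(\<lambda>n. real n powr (2 - 1 / (2 * real r) - \<epsilon>))"
      using eventually_RT_graph[OF assms(1) order_refl _ \<epsilon>'(1) \<theta>_def \<theta>1, simplified]
    proof eventually_elim
      case (elim s)
      then show ?case using exponent
        by (intro RT_in_bigomega[where f = "\<lambda>m. (200 * (real s)\<^sup>2 + 1) * real m powr (1 / 2)"])
           (auto simp: powr_half_sqrt)
    qed
  qed
qed

end
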